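(* Let $\beta>0$ with $\beta^{-1}\in\mathbb{N}$. Let $g:\mathbb{R}\to\mathbb{R}$ be a real-valued function such that, for some constants $C,\lambda,\mu>0$, $|g(x)|\le Ce^{-\lambda|x|}$ for all $x\in\mathbb{R}$ and $|\hat g(\xi)|\le Ce^{-\mu|\xi|}$ for all $\xi\in\mathbb{R}$. Let $G=Z_\beta g$ and assume $$\inf_{x,\xi\in[0,1]}\ \sum_{r=0}^{\beta^{-1}-1}\left|G(x,\xi-\beta r)\right|^2>0.$$ Define $$\Psi(x,\xi)=\frac{1}{\sqrt\beta}\,\frac{G(x,\xi)}{\left(\sum_{r=0}^{\beta^{-1}-1}|G(x,\xi-\beta r)|^2\right)^{1/2}},\qquad \hat\phi(\xi)=(Z_\beta^{-1}\Psi)(\xi)=\sqrt\beta\int_0^1\Psi(x,\beta\xi)\,dx .$$ Then the function $\hat\phi$ is real-valued and satisfies $$\sum_{r=0}^{\beta^{-1}-1}\left|Z_\beta\hat\phi(x,\xi-\beta r)\right|^2=\frac1\beta\quad\text{for almost all }x,\xi\in[0,1].$$ Furthermore, $\phi$ and $\hat\phi$ have exponential decay.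
   Context: The Fourier transform is $\hat f(w)=\int_{\mathbb{R}} f(t)e^{-2\pi i t w}\,dt$ (extended unitarily to $L^2(\mathbb{R})$); $\phi$ denotes the inverse Fourier transform of $\hat\phi$. $\mathbb{N}=\{1,2,\dots\}$. A function $h$ has exponential decay if $|h(x)|\le C'e^{-\lambda'|x|}$ for all $x$, for some $C',\lambda'>0$. The Zak transform is $Z_\beta f(x,\xi)=\frac{1}{\sqrt\beta}\sum_{k\in\mathbb{Z}}f(\beta^{-1}(\xi-k))e^{2\pi i kx}$; it extends to a unitary map from $L^2(\mathbb{R})$ onto the space of functions $F(x,\xi)$ that are square integrable on $[0,1)^2$ and satisfy $F(x+1,\xi)=F(x,\xi)$ and $F(x,\xi+1)=e^{2\pi i x}F(x,\xi)$ a.e., with inverse $(Z_\beta^{-1}F)(\xi)=\sqrt\beta\int_0^1F(x,\beta\xi)\,dx$. For $g$ as in the claim, $G=Z_\beta g$ is a well-defined continuous bounded function. *)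

theory Defs
  imports "HOL-Analysis.Analysis"
begin

text \<open>
  The Fourier integrals are only used for integrable functions, where they agree with the
  unitary extension to \<open>L\<^sup>2\<close>; for an integrable transform, the inverse integral is the
  continuous representative.
\<close>

definition fourier :: "(real \<Rightarrow> complex) \<Rightarrow> real \<Rightarrow> complex" where
  "fourier f w = (LINT t|lebesgue. f t * exp (- 2 * of_real pi * \<i> * of_real t * of_real w))"

definition inv_fourier :: "(real \<Rightarrow> complex) \<Rightarrow> real \<Rightarrow> complex" where
  "inv_fourier f t = (LINT w|lebesgue. f w * exp (2 * of_real pi * \<i> * of_real t * of_real w))"

text \<open>
  The Zak transform is taken pointwise, as an unconditional sum over the integers. It is only
  applied to exponentially decaying functions, for which the sum converges absolutely at every
  point.
\<close>

definition zak :: "real \<Rightarrow> (real \<Rightarrow> complex) \<Rightarrow> real \<Rightarrow> real \<Rightarrow> complex" where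
  "zak \<beta> f x \<xi> = of_real (1 / sqrt \<beta>) *
     (\<Sum>\<^sub>\<infinity>k::int. f (inverse \<beta> * (\<xi> - of_int k)) * exp (2 * of_real pi * \<i> * of_int k * of_real x))"

definition inv_zak :: "real \<Rightarrow> (real \<Rightarrow> real \<Rightarrow> complex) \<Rightarrow> real \<Rightarrow> complex" where
  "inv_zak \<beta> F \<xi> = of_real (sqrt \<beta>) * (LINT x:{0..1}|lebesgue. F x (\<beta> * \<xi>))"

definition exponential_decay :: "(real \<Rightarrow> complex) \<Rightarrow> bool" where
  "exponential_decay h \<longleftrightarrow> (\<exists>C>0. \<exists>l>0. \<forall>x. cmod (h x) \<le> C * exp (- l * \<bar>x\<bar>))"

end

theory Submission
  imports Defs "HOL-Complex_Analysis.Complex_Analysis"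
begin

text \<open>
  For fixed \<open>\<xi>\<close>, the Zak transform \<open>G x \<xi>\<close> is a Fourier series in \<open>x\<close> with exponentially decaying
  coefficients, because \<open>g\<close> decays. For fixed \<open>x\<close>, Poisson summation makes \<open>G x \<xi> * ez (- x * \<xi>)\<close> a
  Fourier series in \<open>\<xi>\<close> with exponentially decaying coefficients, because the Fourier transform of
  \<open>g\<close> decays. Dividing by the square root of the sum of squares preserves exponential decay of the
  coefficients, as everything extends holomorphically and periodically to a strip. Finally, the values
  of \<open>\<phi>hat\<close> are Fourier coefficients of \<open>\<Psi>\<close> in the variable \<open>x\<close>, and the values of \<open>\<phi>\<close> are Fourier
  coefficients of \<open>\<Psi> x \<xi> * ez (- x * \<xi>)\<close> in the variable \<open>\<xi>\<close>.

  The function \<open>g\<close> is given pointwise, and it agrees with a continuous function only almost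
  everywhere. Therefore the decay of \<open>\<phi>hat\<close> and the inversion of the Zak transform are argued at each
  fixed \<open>\<xi>\<close>, while the Poisson formula holds for almost every \<open>\<xi>\<close>.
\<close>

subsection \<open>Fourier series with exponentially decaying coefficients\<close>

text \<open>For this reason \<open>normalized_coeff_decay\<close> produces \<open>B\<close> and
  \<open>b\<close> before the functions \<open>u\<close> are given; they depend only on the number
  of functions, the width of the strip, an upper bound and a lower bound. The factor
  \<open>ez (- x * \<xi>)\<close> turns quasi-periodicity in \<open>\<xi>\<close> into periodicity.
  Having modulus one, it leaves the sum of squares alone, so one normalization lemma serves both
  variables. As the Poisson formula holds only almost everywhere, the lower bound for the dual
  series is known first off a null set; continuity of the series carries it to all points. Integrals
  over the line are folded onto the unit interval by dominated convergence. This makes samples of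
  the transform of \<open>g\<close> coefficients of \<open>G\<close>, and values of the inverse
  transform of \<open>\<phi>hat\<close> coefficients of \<open>\<Psi>\<close>.\<close>

definition ez :: "complex \<Rightarrow> complex" where
  "ez z = exp (2 * of_real pi * \<i> * z)"

lemma ez_add: "ez (a + b) = ez a * ez b"
  by (simp add: ez_def distrib_left exp_add)

lemma ez_0 [simp]: "ez 0 = 1"
  by (simp add: ez_def)

lemma ez_nonzero [simp]: "ez z \<noteq> 0"
  by (simp add: ez_def)

lemma ez_minus: "ez (- z) = inverse (ez z)"
  by (simp add: ez_def exp_minus)

lemma ez_diff: "ez (a - b) = ez a / ez b"
  by (simp add: ez_def right_diff_distrib exp_diff)

lemma norm_ez: "norm (ez z) = exp (- (2 * pi * Im z))"
  by (simp add: ez_def norm_exp_eq_Re)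

lemma cnj_ez: "cnj (ez z) = ez (- cnj z)"
  by (simp add: ez_def exp_cnj)

lemma norm_ez_real [simp]: "Im z = 0 \<Longrightarrow> norm (ez z) = 1"
  by (simp add: norm_ez)

lemma ez_of_int [simp]: "ez (of_int n) = 1"
  using exp_integer_2pi[of "of_int n"] by (simp add: ez_def mult_ac)

lemma ez_of_int_mult_add_1: "ez (of_int n * (z + 1)) = ez (of_int n * z)"
  by (simp add: distrib_left ez_add)

lemma holomorphic_on_ez [holomorphic_intros]:
  "f holomorphic_on S \<Longrightarrow> (\<lambda>z. ez (f z)) holomorphic_on S"
  unfolding ez_def by (intro holomorphic_intros)

lemma continuous_on_ez [continuous_intros]:
  "continuous_on S f \<Longrightarrow> continuous_on S (\<lambda>z. ez (f z))"
  unfolding ez_def by (intro continuous_intros)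

lemma summable_on_exp_abs_int:
  fixes a :: real
  assumes "a > 0"
  shows "(\<lambda>k::int. exp (- a * \<bar>of_int k\<bar>)) summable_on UNIV"
proof -
  have nat: "(\<lambda>n::nat. exp (- a * real n)) summable_on UNIV"
  proof -
    have "summable (\<lambda>n. exp (- a) ^ n)"
      using assms by (intro summable_geometric) auto
    then have "summable (\<lambda>n. norm (exp (- a * real n)))"
      by (simp add: exp_of_nat_mult [symmetric] mult.commute)
    then show ?thesis
      by (rule norm_summable_imp_summable_on)
  qed
  have 1: "(\<lambda>k::int. exp (- a * \<bar>of_int k\<bar>)) summable_on range int"
    using nat by (subst summable_on_reindex) (auto simp: o_def)
  have 2: "(\<lambda>k::int. exp (- a * \<bar>of_int k\<bar>)) summable_on range (\<lambda>n. - int n)"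
    using nat by (subst summable_on_reindex) (auto simp: o_def inj_on_def)
  have "range int \<union> range (\<lambda>n. - int n) = UNIV"
    by (metis (mono_tags, lifting) UNIV_eq_I Un_iff int_cases2 rangeI)
  with summable_on_union[OF 1 2] show ?thesis
    by simp
qed

section \<open>Trigonometric series in a horizontal strip\<close>

definition strip :: "real \<Rightarrow> complex set" where
  "strip \<eta> = {z. \<bar>Im z\<bar> < \<eta>}"

lemma open_strip [simp]: "open (strip \<eta>)"
  unfolding strip_def by (intro open_Collect_less continuous_intros)

lemma convex_strip [simp]: "convex (strip \<eta>)"
proof -
  have "strip \<eta> = {z. Im z < \<eta>} \<inter> {z. Im z > - \<eta>}"
    by (auto simp: strip_def)
  then show ?thesis
    by (simp add: convex_Int convex_halfspace_Im_lt convex_halfspace_Im_gt)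
qed

lemma strip_cnj [simp]: "cnj z \<in> strip \<eta> \<longleftrightarrow> z \<in> strip \<eta>"
  by (simp add: strip_def)

lemma strip_add_1 [simp]: "z + 1 \<in> strip \<eta> \<longleftrightarrow> z \<in> strip \<eta>"
  by (simp add: strip_def)

definition trig_series :: "(int \<Rightarrow> complex) \<Rightarrow> complex \<Rightarrow> complex" where
  "trig_series c z = (\<Sum>\<^sub>\<infinity>k. c k * ez (of_int k * z))"

context
  fixes c :: "int \<Rightarrow> complex" and A a :: real
  assumes c: "\<And>k. norm (c k) \<le> A * exp (- a * \<bar>of_int k\<bar>)" and a: "a > 0"
begin

text \<open>The width \<open>a / (4 * pi)\<close> spends half of the decay rate: there the
  exponential factor grows at most like \<open>exp (a / 2 * \<bar>k\<bar>)\<close>, and the other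
  half of the rate remains for summability.\<close>

lemma trig_term_le:
  assumes "\<bar>Im z\<bar> \<le> a / (4 * pi)"
  shows "norm (c k * ez (of_int k * z)) \<le> A * exp (- (a / 2) * \<bar>of_int k\<bar>)"
proof -
  have "A \<ge> 0"
    using order_trans[OF norm_ge_zero c[of 0]] by simp
  have "2 * pi * \<bar>Im z\<bar> \<le> a / 2"
    using assms by (simp add: field_simps)
  then have "\<bar>of_int k\<bar> * (2 * pi * \<bar>Im z\<bar>) \<le> \<bar>of_int k\<bar> * (a / 2)"
    by (rule mult_left_mono) auto
  moreover have "- (2 * pi * (of_int k * Im z)) \<le> \<bar>of_int k\<bar> * (2 * pi * \<bar>Im z\<bar>)"
  proof -
    have "- (2 * pi * (of_int k * Im z)) \<le> \<bar>2 * pi * (of_int k * Im z)\<bar>"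
      by linarith
    also have "\<dots> = \<bar>of_int k\<bar> * (2 * pi * \<bar>Im z\<bar>)"
      by (simp add: abs_mult)
    finally show ?thesis .
  qed
  ultimately have "- (2 * pi * (of_int k * Im z)) \<le> \<bar>of_int k\<bar> * (a / 2)"
    by (rule order_trans[rotated])
  then have "norm (ez (of_int k * z)) \<le> exp (\<bar>of_int k\<bar> * (a / 2))"
    by (simp add: norm_ez)
  then have "norm (c k * ez (of_int k * z)) \<le> (A * exp (- a * \<bar>of_int k\<bar>)) * exp (\<bar>of_int k\<bar> * (a / 2))"
    unfolding norm_mult using c \<open>A \<ge> 0\<close> by (intro mult_mono) auto
  also have "\<dots> = A * exp (- (a / 2) * \<bar>of_int k\<bar>)"
    by (simp add: mult.assoc flip: exp_add)
  finally show ?thesis .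
qed

lemma trig_summable_majorant:
  "(\<lambda>k::int. A * exp (- (a / 2) * \<bar>of_int k\<bar>)) summable_on UNIV"
  using summable_on_exp_abs_int[of "a / 2"] a by (intro summable_on_cmult_right) auto

lemma trig_series_summable:
  assumes "\<bar>Im z\<bar> \<le> a / (4 * pi)"
  shows "(\<lambda>k. norm (c k * ez (of_int k * z))) summable_on UNIV"
  using trig_term_le[OF assms]
  by (intro summable_on_comparison_test[OF trig_summable_majorant]) auto

text \<open>The bound depends on \<open>A\<close> and \<open>a\<close> alone, so it supplies the
  uniform bound \<open>M\<close> for whole families of coefficient sequences.\<close>

lemma trig_series_bound:
  assumes "\<bar>Im z\<bar> \<le> a / (4 * pi)"
  shows "norm (trig_series c z) \<le> A * (\<Sum>\<^sub>\<infinity>k::int. exp (- (a / 2) * \<bar>of_int k\<bar>))"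
proof -
  have "norm (trig_series c z) \<le> (\<Sum>\<^sub>\<infinity>k. norm (c k * ez (of_int k * z)))"
    unfolding trig_series_def using trig_series_summable[OF assms] by (rule norm_infsum_bound)
  also have "\<dots> \<le> (\<Sum>\<^sub>\<infinity>k::int. A * exp (- (a / 2) * \<bar>of_int k\<bar>))"
    using trig_series_summable[OF assms] trig_summable_majorant trig_term_le[OF assms]
    by (intro infsum_mono) auto
  also have "\<dots> = A * (\<Sum>\<^sub>\<infinity>k::int. exp (- (a / 2) * \<bar>of_int k\<bar>))"
    using summable_on_exp_abs_int[of "a / 2"] a by (intro infsum_cmult_right) auto
  finally show ?thesis .
qed

lemma trig_series_uniform_limit:
  "uniform_limit {z. \<bar>Im z\<bar> \<le> a / (4 * pi)} (\<lambda>X z. \<Sum>k\<in>X. c k * ez (of_int k * z))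
     (trig_series c) (finite_subsets_at_top UNIV)"
  unfolding trig_series_def[abs_def]
  using trig_term_le trig_summable_majorant
  by (intro Weierstrass_m_test_general[where M = "\<lambda>k. A * exp (- (a / 2) * \<bar>of_int k\<bar>)"]) auto

text \<open>The finite partial sums are entire and converge uniformly on closed discs inside the
  strip.\<close>

lemma trig_series_holomorphic: "trig_series c holomorphic_on strip (a / (4 * pi))"
proof -
  have "\<exists>r>0. trig_series c holomorphic_on ball z r" if z: "z \<in> strip (a / (4 * pi))" for z
  proof -
    obtain r where r: "r > 0" "cball z r \<subseteq> strip (a / (4 * pi))"
      using open_contains_cball[of "strip (a / (4 * pi))"] z by auto
    have "uniform_limit (cball z r) (\<lambda>X z. \<Sum>k\<in>X. c k * ez (of_int k * z))
        (trig_series c) (finite_subsets_at_top UNIV)"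
      by (rule uniform_limit_on_subset[OF trig_series_uniform_limit])
        (use r(2) in \<open>auto simp: strip_def less_imp_le\<close>)
    then have "trig_series c holomorphic_on ball z r"
      by (rule holomorphic_uniform_limit[rotated])
        (auto intro!: always_eventually continuous_intros holomorphic_intros)
    with r(1) show ?thesis by blast
  qed
  then show ?thesis
    by (metis analytic_on_def analytic_imp_holomorphic)
qed

lemma trig_series_continuous_real: "continuous_on UNIV (\<lambda>x::real. trig_series c (of_real x))"
proof -
  have "continuous_on (strip (a / (4 * pi))) (trig_series c)"
    by (rule holomorphic_on_imp_continuous_on[OF trig_series_holomorphic])
  then show ?thesis
    by (rule continuous_on_compose2) (use a in \<open>auto simp: strip_def intro!: continuous_intros\<close>)
qed

end

lemma trig_series_add_1: "trig_series c (z + 1) = trig_series c z"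
  by (simp add: trig_series_def ez_of_int_mult_add_1)

lemma integral_ez_int:
  "((\<lambda>x. ez (of_int k * of_real x)) has_integral (if k = 0 then 1 else 0)) {0..1::real}"
proof (cases "k = 0")
  case True
  then show ?thesis
    using has_integral_const_real[of "1::complex" 0 1] by simp
next
  case False
  define w where "w = 2 * of_real pi * \<i> * of_int k"
  have w: "w \<noteq> 0" using False by (simp add: w_def)
  have "((\<lambda>x. exp (w * of_real x)) has_integral (exp (w * of_real 1) / w - exp (w * of_real 0) / w)) {0..1::real}"
    using w by (intro fundamental_theorem_of_calculus)
       (auto intro!: derivative_eq_intros has_vector_derivative_real_field)
  moreover have "exp w = 1"
    using ez_of_int[of k] by (simp add: ez_def w_def del: ez_of_int)
  ultimately show ?thesis
    using False by (simp add: ez_def w_def mult_ac)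
qed

text \<open>Uniform convergence permits integration term by term. By orthogonality the integral of a
  finite partial sum is exactly \<open>c n\<close> once its index set contains \<open>n\<close>, so
  the net of integrals is eventually constant.\<close>

lemma trig_series_coeff:
  assumes c: "\<And>k. norm (c k) \<le> A * exp (- a * \<bar>of_int k\<bar>)" and a: "a > 0"
  shows "integral {0..1::real} (\<lambda>x. trig_series c (of_real x) * ez (- of_int n * of_real x)) = c n"
proof -
  let ?f = "\<lambda>X (x::real). (\<Sum>k\<in>X. c k * ez (of_int k * of_real x)) * ez (- of_int n * of_real x)"
  have u: "uniform_limit (cbox 0 1) ?f
     (\<lambda>x. trig_series c (of_real x) * ez (- of_int n * of_real x)) (finite_subsets_at_top UNIV)"
  proof -
    have 1: "uniform_limit (cbox 0 (1::real)) (\<lambda>X x. \<Sum>k\<in>X. c k * ez (of_int k * of_real x))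
       (\<lambda>x. trig_series c (of_real x)) (finite_subsets_at_top UNIV)"
      by (rule uniform_limit_compose'[OF trig_series_uniform_limit[OF c a]]) (use a in auto)
    have 2: "bounded ((\<lambda>x::real. trig_series c (of_real x)) ` cbox 0 1)"
      using trig_series_bound[OF c a] a
      by (intro boundedI[where B = "A * (\<Sum>\<^sub>\<infinity>k::int. exp (- (a / 2) * \<bar>of_int k\<bar>))"]) auto
    have 3: "bounded ((\<lambda>x::real. ez (- of_int n * of_real x)) ` cbox 0 1)"
      by (intro boundedI[where B = 1]) auto
    show ?thesis
      by (rule uniform_lim_mult[OF 1 uniform_limit_const 2 3])
  qed
  obtain I J where I: "\<And>X. (?f X has_integral I X) (cbox 0 1)"
    and J: "((\<lambda>x. trig_series c (of_real x) * ez (- of_int n * of_real x)) has_integral J) (cbox 0 1)"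
    and lim: "(I \<longlongrightarrow> J) (finite_subsets_at_top UNIV)"
    by (rule uniform_limit_integral_cbox[OF u]) (auto intro!: continuous_intros)
  have "I X = c n" if X: "finite X" "n \<in> X" for X
  proof -
    have "((\<lambda>x. \<Sum>k\<in>X. c k * ez (of_int (k - n) * of_real x)) has_integral
        (\<Sum>k\<in>X. c k * (if k - n = 0 then 1 else 0))) {0..1::real}"
      using X by (intro has_integral_sum has_integral_mult_right integral_ez_int) auto
    moreover have "(\<lambda>x. \<Sum>k\<in>X. c k * ez (of_int (k - n) * of_real x)) = ?f X"
      by (simp add: sum_distrib_right mult.assoc flip: ez_add) (simp add: algebra_simps)
    ultimately have "I X = (\<Sum>k\<in>X. c k * (if k - n = 0 then 1 else 0))"
      using I[of X] by (auto intro: has_integral_unique)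
    also have "\<dots> = c n"
      using X by (simp add: if_distrib cong: if_cong)
    finally show ?thesis .
  qed
  then have "eventually (\<lambda>X. I X = c n) (finite_subsets_at_top UNIV)"
    unfolding eventually_finite_subsets_at_top by (intro exI[of _ "{n}"]) blast
  then have "(I \<longlongrightarrow> c n) (finite_subsets_at_top UNIV)"
    by (rule tendsto_eventually)
  with lim have "J = c n"
    by (intro tendsto_unique) auto
  with J show ?thesis
    by (auto simp: integral_unique)
qed

text \<open>A primitive \<open>H\<close> replaces the rectangular contour. By periodicity
  \<open>H (z + 1) - H z\<close> has derivative 0, so it is one constant on the convex strip, and
  this constant is the integral over every horizontal segment of length 1.\<close>

lemma integral_shift_line:
  fixes h :: "complex \<Rightarrow> complex"
  assumes holo: "h holomorphic_on strip \<eta>"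
    and per: "\<And>z. z \<in> strip \<eta> \<Longrightarrow> h (z + 1) = h z" and y: "\<bar>y\<bar> < \<eta>"
  shows "integral {0..1::real} (\<lambda>x. h (of_real x)) = integral {0..1} (\<lambda>x. h (Complex x y))"
proof -
  have "\<exists>H. \<forall>z\<in>strip \<eta>. (H has_field_derivative h z) (at z within strip \<eta>)"
    using holomorphic_convex_primitive'[OF convex_strip open_strip holo] by metis
  then obtain H where H: "\<And>z. z \<in> strip \<eta> \<Longrightarrow> (H has_field_derivative h z) (at z)"
    by (metis at_within_open open_strip)
  have "\<exists>c. \<forall>z\<in>strip \<eta>. H (z + 1) - H z = c"
  proof (rule has_field_derivative_zero_constant)
    fix z assume z: "z \<in> strip \<eta>"
    have "((\<lambda>z. H (z + 1)) has_field_derivative h (z + 1)) (at z)"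
      using H[of "z + 1"] z DERIV_shift[of H "h (z + 1)" z 1] by simp
    from DERIV_diff[OF this H[OF z]] show
      "((\<lambda>z. H (z + 1) - H z) has_field_derivative 0) (at z within strip \<eta>)"
      using per[OF z] by (auto intro: has_field_derivative_at_within)
  qed simp
  then obtain d where d: "\<And>z. z \<in> strip \<eta> \<Longrightarrow> H (z + 1) - H z = d" by blast
  have int: "((\<lambda>x. h (Complex x t)) has_integral d) {0..1::real}" if t: "\<bar>t\<bar> < \<eta>" for t
  proof -
    have "((\<lambda>x. h (Complex x t)) has_integral (H (Complex 1 t) - H (Complex 0 t))) {0..1::real}"
    proof (rule fundamental_theorem_of_calculus)
      fix x :: real
      have "((\<lambda>z. H (z + \<i> * of_real t)) has_field_derivative h (of_real x + \<i> * of_real t)) (at (of_real x))"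
        using H[of "of_real x + \<i> * of_real t"] t DERIV_shift[of H _ "of_real x" "\<i> * of_real t"]
        by (simp add: strip_def)
      from has_vector_derivative_real_field[OF this]
      show "((\<lambda>x. H (Complex x t)) has_vector_derivative h (Complex x t)) (at x within {0..1})"
        by (simp add: Complex_eq)
    qed simp
    moreover have "H (Complex 1 t) - H (Complex 0 t) = d"
      using d[of "Complex 0 t"] t by (simp add: strip_def Complex_eq add.commute)
    ultimately show ?thesis by simp
  qed
  have "\<eta> > 0" using y by linarith
  then have "((\<lambda>x. h (Complex x 0)) has_integral d) {0..1::real}"
    by (intro int) simp
  with int[OF y] show ?thesis
    by (simp add: integral_unique complex_of_real_def)
qed

subsection \<open>Normalization in a strip\<close>

text \<open>
  The sum of squares extends holomorphically to \<open>\<Sum>r<N. u r z * cnj (u r (cnj z))\<close>, whose real part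
  stays away from 0 on a thinner strip, and the line of integration is moved to the edge of that strip.
\<close>

lemma normalized_coeff_decay:
  fixes \<eta> M \<delta> :: real
  assumes N: "N > 0" and pos: "\<eta> > 0" "M > 0" "\<delta> > 0"
  obtains B b where "B > 0" "b > 0"
    "\<And>u n. (\<And>r. r < N \<Longrightarrow> u r holomorphic_on strip \<eta>) \<Longrightarrow>
       (\<And>r z. r < N \<Longrightarrow> z \<in> strip \<eta> \<Longrightarrow> u r (z + 1) = u r z) \<Longrightarrow>
       (\<And>r z. r < N \<Longrightarrow> z \<in> strip \<eta> \<Longrightarrow> norm (u r z) \<le> M) \<Longrightarrow>
       (\<And>x. \<delta> \<le> (\<Sum>r<N. (cmod (u r (of_real x)))\<^sup>2)) \<Longrightarrow>
       norm (integral {0..1::real} (\<lambda>x. u (0::nat) (of_real x) /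
         of_real (sqrt (\<Sum>r<N. (cmod (u r (of_real x)))\<^sup>2)) * ez (- of_int n * of_real x)))
         \<le> B * exp (- b * \<bar>of_int n\<bar>)"
proof -
  define L where "L = real N * M\<^sup>2"
  have L: "L > 0" using N pos by (simp add: L_def)
  \<comment> \<open>\<open>L\<close> bounds \<open>s\<close> on the full strip. Cauchy's inequality
    with radius \<open>\<eta> / 4\<close> bounds the derivative by \<open>4 * L / \<eta>\<close> on
    the half strip, so at height below \<open>\<delta> * \<eta> / (8 * L)\<close> the value of
    \<open>s\<close> differs by at most \<open>\<delta> / 2\<close> from that on the real
    line.\<close>
  define \<eta>1 where "\<eta>1 = min (\<eta> / 2) (\<delta> * \<eta> / (8 * L))"
  have \<eta>1: "\<eta>1 > 0" "\<eta>1 \<le> \<eta> / 2" "\<eta>1 \<le> \<delta> * \<eta> / (8 * L)"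
    using pos L by (auto simp: \<eta>1_def)
  define B where "B = M / sqrt (\<delta> / 2)"
  have B: "B > 0" using pos by (simp add: B_def)
  show ?thesis
  proof (rule that[of B "pi * \<eta>1"])
    show "B > 0" "pi * \<eta>1 > 0" using B \<eta>1 by auto
    fix u :: "nat \<Rightarrow> complex \<Rightarrow> complex" and n :: int
    assume holo: "\<And>r. r < N \<Longrightarrow> u r holomorphic_on strip \<eta>"
      and per: "\<And>r z. r < N \<Longrightarrow> z \<in> strip \<eta> \<Longrightarrow> u r (z + 1) = u r z"
      and bd: "\<And>r z. r < N \<Longrightarrow> z \<in> strip \<eta> \<Longrightarrow> norm (u r z) \<le> M"
      and low: "\<And>x. \<delta> \<le> (\<Sum>r<N. (cmod (u r (of_real x)))\<^sup>2)"
    define s where "s z = (\<Sum>r<N. u r z * cnj (u r (cnj z)))" for z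
    have s_holo: "s holomorphic_on strip \<eta>"
    proof -
      have "(\<lambda>z. cnj (u r (cnj z))) holomorphic_on strip \<eta>" if "r < N" for r
      proof -
        have "cnj ` strip \<eta> = strip \<eta>"
          by (metis (no_types, lifting) complex_cnj_cnj image_iff strip_cnj subsetI subset_antisym image_subset_iff)
        then have "cnj \<circ> u r \<circ> cnj holomorphic_on strip \<eta>"
          using holo[OF that] by (intro holomorphic_on_compose_cnj_cnj) auto
        then show ?thesis by (simp add: o_def)
      qed
      then show ?thesis
        unfolding s_def[abs_def] using holo by (intro holomorphic_intros) auto
    qed
    have s_real: "s (of_real x) = of_real (\<Sum>r<N. (cmod (u r (of_real x)))\<^sup>2)" for x
      by (simp add: s_def flip: complex_norm_square)
    have s_bd: "norm (s z) \<le> L" if z: "z \<in> strip \<eta>" for z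
    proof -
      have "norm (s z) \<le> (\<Sum>r<N. M * M)"
        unfolding s_def using z pos
        by (intro sum_norm_le) (auto simp: norm_mult intro!: mult_mono bd)
      then show ?thesis by (simp add: L_def power2_eq_square)
    qed
    have s'_bd: "norm (deriv s z) \<le> 4 * L / \<eta>" if z: "z \<in> strip (\<eta> / 2)" for z
    proof -
      have sub: "cball z (\<eta> / 4) \<subseteq> strip \<eta>"
      proof
        fix w assume "w \<in> cball z (\<eta> / 4)"
        then have "\<bar>Im z - Im w\<bar> \<le> \<eta> / 4"
          using abs_Im_le_cmod[of "z - w"] by (simp add: dist_norm)
        moreover have "\<bar>Im z\<bar> < \<eta> / 2" using z by (simp add: strip_def)
        ultimately have "\<bar>Im w\<bar> < \<eta>" using pos by linarith
        then show "w \<in> strip \<eta>" by (simp add: strip_def)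
      qed
      have "norm ((deriv ^^ 1) s z) \<le> fact 1 * L / (\<eta> / 4) ^ 1"
      proof (rule Cauchy_inequality)
        show "s holomorphic_on ball z (\<eta> / 4)"
          using s_holo by (rule holomorphic_on_subset) (use sub in auto)
        show "continuous_on (cball z (\<eta> / 4)) s"
          using holomorphic_on_imp_continuous_on[OF s_holo] by (rule continuous_on_subset) (use sub in auto)
        show "norm (s w) \<le> L" if "norm (z - w) = \<eta> / 4" for w
          using that sub by (intro s_bd) (auto simp: dist_norm)
      qed (use pos in auto)
      then show ?thesis by (simp add: mult.commute)
    qed
    have s_low: "Re (s z) \<ge> \<delta> / 2" if z: "z \<in> strip \<eta>1" for z
    proof -
      have "norm (s z - s (of_real (Re z))) \<le> 4 * L / \<eta> * norm (z - of_real (Re z))"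
      proof (rule field_differentiable_bound)
        show "convex (strip (\<eta> / 2))" by simp
        show "(s has_field_derivative deriv s w) (at w within strip (\<eta> / 2))" if "w \<in> strip (\<eta> / 2)" for w
        proof -
          have "w \<in> strip \<eta>" using that pos by (simp add: strip_def)
          then show ?thesis
            by (rule has_field_derivative_at_within[OF holomorphic_derivI[OF s_holo open_strip]])
        qed
      qed (use s'_bd z \<eta>1 in \<open>auto simp: strip_def\<close>)
      also have "norm (z - of_real (Re z)) = \<bar>Im z\<bar>"
        by (simp add: cmod_def)
      also have "4 * L / \<eta> * \<bar>Im z\<bar> \<le> 4 * L / \<eta> * (\<delta> * \<eta> / (8 * L))"
        using z \<eta>1 L pos by (intro mult_left_mono) (auto simp: strip_def)
      also have "\<dots> = \<delta> / 2"
        using L pos by (simp add: field_simps)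
      finally have "\<bar>Re (s z) - Re (s (of_real (Re z)))\<bar> \<le> \<delta> / 2"
        using abs_Re_le_cmod[of "s z - s (of_real (Re z))"] by simp
      moreover have "Re (s (of_real (Re z))) \<ge> \<delta>"
        unfolding s_real using low by simp
      ultimately show ?thesis by linarith
    qed
    have sub: "strip \<eta>1 \<subseteq> strip \<eta>"
      using \<eta>1 pos by (auto simp: strip_def)
    define h where "h z = u 0 z / csqrt (s z) * ez (- of_int n * z)" for z
    have "h holomorphic_on strip \<eta>1"
      unfolding h_def
    proof (intro holomorphic_intros)
      show "u 0 holomorphic_on strip \<eta>1" "s holomorphic_on strip \<eta>1"
        using holo[OF N] s_holo sub by (auto intro: holomorphic_on_subset)
      \<comment> \<open>The values of \<open>s\<close> lie in the right half plane, so the principal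
        root is holomorphic there, and it is the usual positive root on the real line.\<close>
      show "s z \<notin> \<real>\<^sub>\<le>\<^sub>0" if "z \<in> strip \<eta>1" for z
        using s_low[OF that] pos by (auto simp: complex_nonpos_Reals_iff)
      show "csqrt (s z) \<noteq> 0" if "z \<in> strip \<eta>1" for z
        using s_low[OF that] pos by auto
    qed
    moreover have "h (z + 1) = h z" if z: "z \<in> strip \<eta>1" for z
    proof -
      have "z \<in> strip \<eta>" using z sub by auto
      then have "s (z + 1) = s z"
        unfolding s_def using per by (intro sum.cong) auto
      then show ?thesis
        using ez_of_int_mult_add_1[of "- n" z] per[OF N \<open>z \<in> strip \<eta>\<close>] by (simp add: h_def)
    qed
    \<comment> \<open>The sign of \<open>y\<close> is opposite to that of \<open>n\<close>, which
      makes \<open>ez (- n * z)\<close> of modulus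
      \<open>exp (- pi * \<eta>1 * \<bar>n\<bar>)\<close> on the shifted line; this is the origin of
      the rate \<open>pi * \<eta>1\<close>. The half keeps the line inside the open strip.\<close>
    moreover define y where "y = - sgn (of_int n) * (\<eta>1 / 2)"
    have y: "\<bar>y\<bar> < \<eta>1" using \<eta>1 by (simp add: y_def abs_mult sgn_if)
    ultimately have h_holo: "h holomorphic_on strip \<eta>1"
      and shift: "integral {0..1::real} (\<lambda>x. h (of_real x)) = integral {0..1} (\<lambda>x. h (Complex x y))"
      by (auto intro: integral_shift_line)
    have "h (of_real x) = u 0 (of_real x) /
         of_real (sqrt (\<Sum>r<N. (cmod (u r (of_real x)))\<^sup>2)) * ez (- of_int n * of_real x)" for x :: real
      unfolding h_def s_real by (simp only: of_real_sqrt[OF sum_nonneg] zero_le_power2)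
    moreover have "norm (integral {0..1::real} (\<lambda>x. h (Complex x y))) \<le> B * exp (- (pi * \<eta>1) * \<bar>of_int n\<bar>)"
    proof -
      have bd: "norm (h (Complex x y)) \<le> B * exp (- (pi * \<eta>1) * \<bar>of_int n\<bar>)" for x
      proof -
        have z: "Complex x y \<in> strip \<eta>1" using y by (simp add: strip_def)
        have "sqrt (\<delta> / 2) \<le> sqrt (norm (s (Complex x y)))"
          using s_low[OF z] complex_Re_le_cmod[of "s (Complex x y)"] by (intro real_sqrt_le_mono) linarith
        moreover have "norm (csqrt (s (Complex x y))) = sqrt (norm (s (Complex x y)))"
          by (metis norm_power power2_csqrt norm_ge_zero real_sqrt_unique)
        moreover have "norm (u 0 (Complex x y)) \<le> M"
          using bd[OF N] z sub by auto
        ultimately have "norm (u 0 (Complex x y) / csqrt (s (Complex x y))) \<le> B"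
          unfolding B_def norm_divide using pos by (intro frac_le) auto
        moreover have "norm (ez (- of_int n * Complex x y)) = exp (- (pi * \<eta>1) * \<bar>of_int n\<bar>)"
          by (simp add: norm_ez y_def sgn_if)
        ultimately show ?thesis
          unfolding h_def norm_mult by (metis exp_ge_zero mult_right_mono)
      qed
      have "continuous_on {0..1} (\<lambda>x. h (Complex x y))"
        by (rule continuous_on_compose2[OF holomorphic_on_imp_continuous_on[OF h_holo]])
          (use y in \<open>auto simp: strip_def Complex_eq intro!: continuous_intros\<close>)
      from integral_bound[OF _ this] bd show ?thesis
        by fastforce
    qed
    ultimately show "norm (integral {0..1::real} (\<lambda>x. u (0::nat) (of_real x) /
         of_real (sqrt (\<Sum>r<N. (cmod (u r (of_real x)))\<^sup>2)) * ez (- of_int n * of_real x)))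
         \<le> B * exp (- (pi * \<eta>1) * \<bar>of_int n\<bar>)"
      using shift by simp
  qed
qed

subsection \<open>Uniqueness of Fourier coefficients\<close>

text \<open>Boundedness makes products with continuous functions integrable, so the class is stable
  under multiplication by trigonometric polynomials. Measurability in place of continuity admits the
  periodizations of \<open>g\<close>.\<close>

definition null_coeffs :: "(real \<Rightarrow> complex) \<Rightarrow> bool" where
  "null_coeffs h \<longleftrightarrow> h \<in> borel_measurable (lebesgue_on {0..1}) \<and> bounded (h ` {0..1}) \<and>
     (\<forall>n::int. integral {0..1} (\<lambda>x. h x * ez (of_int n * of_real x)) = 0)"

lemma bounded_measurable_integrable:
  fixes h :: "real \<Rightarrow> complex"
  assumes "h \<in> borel_measurable (lebesgue_on {a..b})" "bounded (h ` {a..b})"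
  shows "h integrable_on {a..b}"
proof -
  obtain K where "\<And>x. x \<in> {a..b} \<Longrightarrow> norm (h x) \<le> K"
    using assms(2) unfolding bounded_iff by fast
  then show ?thesis
    by (rule measurable_bounded_by_integrable_imp_integrable[OF assms(1) integrable_const_ivl]) auto
qed

lemma bounded_mult_continuous:
  fixes h k :: "real \<Rightarrow> complex"
  assumes "h \<in> borel_measurable (lebesgue_on {a..b})" "bounded (h ` {a..b})"
    and k: "continuous_on {a..b} k"
  shows "(\<lambda>x. h x * k x) \<in> borel_measurable (lebesgue_on {a..b})"
    and "bounded ((\<lambda>x. h x * k x) ` {a..b})"
    and "(\<lambda>x. h x * k x) integrable_on {a..b}"
proof -
  show meas: "(\<lambda>x. h x * k x) \<in> borel_measurable (lebesgue_on {a..b})"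
    using assms continuous_imp_measurable_on_sets_lebesgue[OF k] by (intro borel_measurable_times) auto
  obtain K where K: "\<And>x. x \<in> {a..b} \<Longrightarrow> norm (h x) \<le> K"
    using assms(2) unfolding bounded_iff by fast
  have "bounded (k ` {a..b})"
    by (intro compact_imp_bounded compact_continuous_image k) auto
  then obtain L where L: "\<And>x. x \<in> {a..b} \<Longrightarrow> norm (k x) \<le> L"
    unfolding bounded_iff by fast
  have "norm (h x * k x) \<le> K * L" if "x \<in> {a..b}" for x
    unfolding norm_mult using K[OF that] L[OF that]
    by (intro mult_mono) (auto intro: order_trans[OF norm_ge_zero])
  then show bd: "bounded ((\<lambda>x. h x * k x) ` {a..b})"
    by (intro boundedI[where B = "K * L"]) blast
  show "(\<lambda>x. h x * k x) integrable_on {a..b}"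
    using meas bd by (rule bounded_measurable_integrable)
qed

text \<open>A real linear form is a combination of \<open>Re\<close> and \<open>Im\<close>, and
  these are combinations of a point of the unit circle and its conjugate. Multiplication by such a
  form therefore shifts Fourier indices by 1 and -1.\<close>

lemma bounded_linear_ez:
  assumes "bounded_linear (p :: complex \<Rightarrow> real)"
  obtains \<alpha> \<gamma> where "\<And>x::real. of_real (p (ez (of_real x))) = \<alpha> * ez (of_real x) + \<gamma> * ez (- of_real x)"
proof -
  interpret bounded_linear p by fact
  have p: "p z = Re z * p 1 + Im z * p \<i>" for z
  proof -
    have "p z = p (Re z *\<^sub>R 1 + Im z *\<^sub>R \<i>)"
      by (rule arg_cong[of _ _ p]) (simp add: complex_eq_iff)
    then show ?thesis by (simp add: add scaleR)
  qed
  have "of_real (p (ez (of_real x))) =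
      (p 1 - \<i> * p \<i>) / 2 * ez (of_real x) + (p 1 + \<i> * p \<i>) / 2 * ez (- of_real x)" for x :: real
  proof -
    define q where "q = ez (of_real x)"
    have q: "ez (- of_real x) = cnj q"
      by (simp add: q_def cnj_ez)
    show ?thesis
      unfolding q q_def[symmetric] p[of q] by (simp add: complex_eq_iff field_simps)
  qed
  then show ?thesis by (rule that)
qed

text \<open>Linear forms only mix neighbouring coefficients, all of which vanish. The induction
  keeps \<open>h\<close> arbitrary because the product case applies the hypothesis for
  \<open>q\<close> to the function already multiplied by \<open>p\<close>.\<close>

lemma null_coeffs_mult_real_polynomial:
  assumes "real_polynomial_function p" "null_coeffs h"
  shows "null_coeffs (\<lambda>x. h x * of_real (p (ez (of_real x))))"
  using assms
proof (induction arbitrary: h rule: real_polynomial_function.induct)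
  case (linear p)
  obtain \<alpha> \<gamma> where p: "\<And>x::real. of_real (p (ez (of_real x))) = \<alpha> * ez (of_real x) + \<gamma> * ez (- of_real x)"
    using bounded_linear_ez[OF linear(1)] by blast
  have h: "h \<in> borel_measurable (lebesgue_on {0..1})" "bounded (h ` {0..1})"
    and z: "\<And>n. integral {0..1} (\<lambda>x. h x * ez (of_int n * of_real x)) = 0"
    using linear(2) by (auto simp: null_coeffs_def)
  have int: "(\<lambda>x. h x * ez (of_int n * of_real x)) integrable_on {0..1}" for n
    by (intro bounded_mult_continuous(3)[OF h] continuous_intros)
  have "integral {0..1} (\<lambda>x. h x * (\<alpha> * ez (of_real x) + \<gamma> * ez (- of_real x)) * ez (of_int n * of_real x)) = 0" for n
  proof -
    have "(\<lambda>x. h x * (\<alpha> * ez (of_real x) + \<gamma> * ez (- of_real x)) * ez (of_int n * of_real x)) =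
       (\<lambda>x. \<alpha> * (h x * ez (of_int (n + 1) * of_real x)) + \<gamma> * (h x * ez (of_int (n - 1) * of_real x)))"
      by (rule ext) (simp add: ring_distribs ez_add ez_diff ez_minus field_simps)
    then show ?thesis
      using int[of "n + 1"] int[of "n - 1"] z[of "n + 1"] z[of "n - 1"]
      by (simp only: integral_add[OF integrable_on_mult_right integrable_on_mult_right] integral_mult_right) simp
  qed
  then show ?case
    unfolding null_coeffs_def p by (intro conjI allI bounded_mult_continuous(1,2)[OF h] continuous_intros)
next
  case (const c)
  have h: "h \<in> borel_measurable (lebesgue_on {0..1})" "bounded (h ` {0..1})"
    and z: "\<And>n. integral {0..1} (\<lambda>x. h x * ez (of_int n * of_real x)) = 0"
    using const by (auto simp: null_coeffs_def)
  have "integral {0..1} (\<lambda>x. h x * of_real c * ez (of_int n * of_real x)) = 0" for n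
    using z[of n] integral_mult_right[of "{0..1}" "of_real c" "\<lambda>x. h x * ez (of_int n * of_real x)"]
    by (simp add: mult_ac)
  then show ?case
    unfolding null_coeffs_def using bounded_mult_continuous(1,2)[OF h, of "\<lambda>_. of_real c"] by auto
next
  case (add p q)
  have h: "h \<in> borel_measurable (lebesgue_on {0..1})" "bounded (h ` {0..1})"
    using add.prems by (auto simp: null_coeffs_def)
  have p: "null_coeffs (\<lambda>x. h x * of_real (p (ez (of_real x))))"
    and q: "null_coeffs (\<lambda>x. h x * of_real (q (ez (of_real x))))"
    using add by auto
  have int: "(\<lambda>x. k x * ez (of_int n * of_real x)) integrable_on {0..1}" if "null_coeffs k" for k n
    using that by (intro bounded_mult_continuous(3) continuous_intros) (auto simp: null_coeffs_def)
  have "continuous_on UNIV (\<lambda>x::real. of_real (p (ez (of_real x)) + q (ez (of_real x))) :: complex)"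
  proof -
    have pq: "continuous_on UNIV p" "continuous_on UNIV q"
      using add.hyps continuous_real_polymonial_function continuous_at_imp_continuous_on by blast+
    have ez: "continuous_on UNIV (\<lambda>x::real. ez (of_real x))"
      by (intro continuous_intros)
    show ?thesis
      by (intro continuous_on_of_real continuous_on_add
          continuous_on_compose2[OF pq(1) ez] continuous_on_compose2[OF pq(2) ez]) auto
  qed
  then have "continuous_on {0..1} (\<lambda>x::real. of_real (p (ez (of_real x)) + q (ez (of_real x))) :: complex)"
    by (rule continuous_on_subset) auto
  note bounded_mult_continuous(1,2)[OF h this]
  moreover have "integral {0..1} (\<lambda>x. h x * of_real (p (ez (of_real x)) + q (ez (of_real x))) * ez (of_int n * of_real x)) = 0" for n
    using integral_add[OF int[OF p, of n] int[OF q, of n]] p q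
    by (simp add: null_coeffs_def distrib_left distrib_right)
  ultimately show ?case
    unfolding null_coeffs_def by blast
next
  case (mult p q)
  then show ?case
    using mult.IH(2)[OF mult.IH(1)[OF mult.prems]] by (simp add: mult.assoc)
qed

lemma ez_eq_1_imp_int:
  assumes "ez (of_real t) = 1"
  shows "t \<in> \<int>"
proof -
  have "exp (of_real (2 * pi * t) * \<i>) = 1"
    using assms by (simp add: ez_def mult_ac)
  then obtain n :: int where "2 * pi * t = of_int (2 * n) * pi"
    by (auto simp: exp_eq_1)
  then have "t = of_int n" by simp
  then show ?thesis by simp
qed

text \<open>
  A continuous function on \<open>[0, 1]\<close> with equal end values descends to the unit circle, where the
  Stone--Weierstrass theorem applies.
\<close>

lemma null_coeffs_integral_real:
  fixes f :: "real \<Rightarrow> real"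
  assumes h: "null_coeffs h" and f: "continuous_on {0..1} f" "f 0 = f 1"
  shows "integral {0..1} (\<lambda>x. h x * of_real (f x)) = 0"
proof -
  let ?e = "\<lambda>x::real. ez (of_real x)"
  define S where "S = ?e ` {0..1}"
  \<comment> \<open>The chosen preimage is immaterial: on \<open>[0, 1]\<close> the map to the
    circle identifies only 0 and 1, where \<open>f\<close> takes the same value.\<close>
  define F where "F q = f (SOME x. x \<in> {0..1} \<and> ?e x = q)" for q
  have F: "F (?e x) = f x" if x: "x \<in> {0..1}" for x
  proof -
    define y where "y = (SOME y. y \<in> {0..1} \<and> ?e y = ?e x)"
    have y: "y \<in> {0..1}" "?e y = ?e x"
      using someI[of "\<lambda>y. y \<in> {0..1} \<and> ?e y = ?e x" x] x by (auto simp: y_def)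
    then have "ez (of_real (y - x)) = 1"
      by (simp add: ez_diff)
    from ez_eq_1_imp_int[OF this] obtain n where n: "y - x = of_int n"
      by (elim Ints_cases)
    with x y have "- 1 \<le> (of_int n :: real)" "(of_int n :: real) \<le> 1" by auto
    then have "n = -1 \<or> n = 0 \<or> n = 1" by linarith
    then have "y = x \<or> (y = 0 \<and> x = 1) \<or> (y = 1 \<and> x = 0)"
      using n x y by auto
    then show ?thesis
      unfolding F_def y_def[symmetric] using f(2) by metis
  qed
  have e: "continuous_on A ?e" for A
    by (intro continuous_intros)
  have S: "compact S"
    unfolding S_def by (intro compact_continuous_image e) auto
  \<comment> \<open>The map from \<open>[0, 1]\<close> onto the circle is closed by compactness,
    hence a quotient map, and \<open>F\<close> inherits continuity from \<open>f\<close>.\<close>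
  have "continuous_on S F"
  proof (subst continuous_on_closed_vimage)
    show "closed S" using S by (rule compact_imp_closed)
    show "\<forall>B. closed B \<longrightarrow> closed (F -` B \<inter> S)"
    proof (intro allI impI)
      fix B :: "real set" assume "closed B"
      then have "closed ({0..1} \<inter> f -` B)"
        using continuous_closed_preimage f(1) by blast
      then have "compact ({0..1} \<inter> f -` B)"
        by (metis compact_Icc compact_Int_closed inf.left_idem)
      then have "compact (?e ` ({0..1} \<inter> f -` B))"
        by (intro compact_continuous_image e)
      moreover have "F -` B \<inter> S = ?e ` ({0..1} \<inter> f -` B)"
        using F by (auto simp: S_def)
      ultimately show "closed (F -` B \<inter> S)"
        by (simp add: compact_imp_closed)
    qed
  qed
  have h': "h \<in> borel_measurable (lebesgue_on {0..1})" "bounded (h ` {0..1})"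
    using h by (auto simp: null_coeffs_def)
  obtain K where K: "K > 0" "\<And>x. x \<in> {0..1} \<Longrightarrow> norm (h x) \<le> K"
    using h'(2) unfolding bounded_pos by fast
  have "norm (integral {0..1} (\<lambda>x. h x * of_real (f x))) \<le> e" if "e > 0" for e
  proof -
    have "e / K > 0"
      using K(1) that by simp
    obtain p where p: "real_polynomial_function p" "\<And>q. q \<in> S \<Longrightarrow> \<bar>F q - p q\<bar> < e / K"
      by (rule Stone_Weierstrass_real_polynomial_function[OF S \<open>continuous_on S F\<close> \<open>e / K > 0\<close>]) blast
    have "null_coeffs (\<lambda>x. h x * of_real (p (?e x)))"
      using null_coeffs_mult_real_polynomial[OF p(1) h] .
    then have z: "integral {0..1} (\<lambda>x. h x * of_real (p (?e x))) = 0"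
      and i1: "(\<lambda>x. h x * of_real (p (?e x))) integrable_on {0..1}"
      unfolding null_coeffs_def by (auto dest: spec[of _ 0] intro: bounded_measurable_integrable)
    have i2: "(\<lambda>x. h x * of_real (f x)) integrable_on {0..1}"
      by (intro bounded_mult_continuous(3)[OF h'] continuous_intros f)
    have "integral {0..1} (\<lambda>x. h x * of_real (f x)) =
        integral {0..1} (\<lambda>x. h x * of_real (f x) - h x * of_real (p (?e x)))"
      using z i1 i2 by (simp add: integral_diff)
    also have "norm \<dots> \<le> integral {0..1::real} (\<lambda>x. e)"
    proof (rule integral_norm_bound_integral)
      fix x :: real assume x: "x \<in> {0..1}"
      then have "\<bar>f x - p (?e x)\<bar> \<le> e / K"
        using p(2)[of "?e x"] F[OF x] by (auto simp: S_def)
      then have "norm (h x) * \<bar>f x - p (?e x)\<bar> \<le> K * (e / K)"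
        using K(1) K(2)[OF x] by (intro mult_mono) auto
      moreover have "norm (h x * of_real (f x) - h x * of_real (p (?e x))) = norm (h x) * \<bar>f x - p (?e x)\<bar>"
        by (metis norm_mult norm_of_real of_real_diff right_diff_distrib)
      ultimately show "norm (h x * of_real (f x) - h x * of_real (p (?e x))) \<le> e"
        using K by simp
    qed (use i1 i2 in \<open>auto intro: integrable_diff\<close>)
    finally show ?thesis by simp
  qed
  from field_le_epsilon[of _ 0, simplified, OF this]
  have "norm (integral {0..1} (\<lambda>x. h x * of_real (f x))) \<le> 0"
    by simp
  then show ?thesis by simp
qed

lemma null_coeffs_integral:
  fixes f :: "real \<Rightarrow> complex"
  assumes h: "null_coeffs h" and f: "continuous_on {0..1} f" "f 0 = f 1"
  shows "integral {0..1} (\<lambda>x. h x * f x) = 0"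
proof -
  have h': "h \<in> borel_measurable (lebesgue_on {0..1})" "bounded (h ` {0..1})"
    using h by (auto simp: null_coeffs_def)
  have "(\<lambda>x. h x * f x) = (\<lambda>x. h x * of_real (Re (f x)) + \<i> * (h x * of_real (Im (f x))))"
    by (rule ext, subst complex_eq[of "f _"]) (simp add: algebra_simps)
  moreover have "integral {0..1} (\<lambda>x. h x * of_real (Re (f x))) = 0"
    "integral {0..1} (\<lambda>x. h x * of_real (Im (f x))) = 0"
    using f by (auto intro!: null_coeffs_integral_real[OF h] continuous_intros)
  moreover have "(\<lambda>x. h x * of_real (Re (f x))) integrable_on {0..1}"
    "(\<lambda>x. h x * of_real (Im (f x))) integrable_on {0..1}"
    using f by (auto intro!: bounded_mult_continuous(3)[OF h'] continuous_intros)
  ultimately show ?thesis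
    by (simp add: integral_add integrable_on_mult_right)
qed

text \<open>The conjugate of \<open>h\<close> is itself an admissible test function, which gives a
  vanishing integral of the squared modulus; continuity does the rest.\<close>

lemma null_coeffs_continuous_eq_0:
  assumes h: "null_coeffs h" "continuous_on {0..1} h" "h 0 = h 1" and x: "x \<in> {0..1}"
  shows "h x = 0"
proof -
  have cont: "continuous_on {0..1} (\<lambda>x. (cmod (h x))\<^sup>2)"
    using h by (intro continuous_intros)
  have "of_real (integral {0..1} (\<lambda>x. (cmod (h x))\<^sup>2)) = integral {0..1} (\<lambda>x. h x * cnj (h x))"
    using integral_linear[OF integrable_continuous_real[OF cont] bounded_linear_of_real[where 'a = complex]]
    by (simp add: o_def complex_norm_square del: of_real_power)
  also have "\<dots> = 0"
    using h by (intro null_coeffs_integral continuous_intros) auto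
  finally have "((\<lambda>x. (cmod (h x))\<^sup>2) has_integral 0) (cbox 0 1)"
    using integrable_integral[OF integrable_continuous_real[OF cont]] by simp
  then have "(cmod (h x))\<^sup>2 = 0"
    using x cont by (intro has_integral_0_cbox_imp_0[where f = "\<lambda>x. (cmod (h x))\<^sup>2" and a = 0 and b = 1]) auto
  then show ?thesis by simp
qed

text \<open>The conjugate of \<open>h\<close> is now only measurable, so it is approximated almost
  everywhere by admissible continuous functions \<open>f n\<close>. Dominated convergence again
  makes the integral of the squared modulus vanish.\<close>

lemma null_coeffs_negligible:
  assumes h: "null_coeffs h"
  shows "negligible {x \<in> {0..1}. h x \<noteq> 0}"
proof -
  have h': "h \<in> borel_measurable (lebesgue_on {0..1})" "bounded (h ` {0..1})"
    using h by (auto simp: null_coeffs_def)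
  obtain K where K: "K > 0" "\<And>x. x \<in> {0..1} \<Longrightarrow> norm (h x) \<le> K"
    using h'(2) by (auto simp: bounded_pos)
  have "(\<lambda>x. cnj (h x)) measurable_on {0..1}"
    using h'(1) by (subst measurable_on_iff_borel_measurable)
      (auto intro: borel_measurable_continuous_onI[THEN measurable_compose[rotated]] continuous_intros)
  then obtain T g where T: "negligible T" and g: "\<And>n. continuous_on UNIV (g n)"
    and lim: "\<And>x. x \<notin> T \<Longrightarrow> (\<lambda>n. g n x) \<longlonglongrightarrow> (if x \<in> {0..1} then cnj (h x) else 0)"
    unfolding measurable_on_def by blast
  \<comment> \<open>Projection to the disc of radius \<open>K\<close> gives the approximants a
    common bound and fixes the values of the limit.\<close>
  define P where "P = closest_point (cball (0::complex) K)"
  have P: "continuous_on A P" for A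
    unfolding P_def using K by (intro continuous_on_closest_point) auto
  have P_le: "norm (P z) \<le> K" for z
    using closest_point_in_set[of "cball (0::complex) K" z] K by (simp add: P_def)
  have P_id: "P z = z" if "norm z \<le> K" for z
    using that by (simp add: P_def closest_point_self)
  \<comment> \<open>The cutoff vanishes at 0 and 1, which forces equal end values, and equals 1 from
    some \<open>n\<close> on at every interior point.\<close>
  define k where "k n x = min 1 (real n * min x (1 - x))" for n x
  define f where "f n x = P (g n x) * of_real (k n x)" for n x
  define U where "U = {0, 1} \<union> T"
  have U: "negligible U"
    unfolding U_def using T by (simp add: negligible_Un negligible_insert)
  have f_cont: "continuous_on {0..1} (f n)" for n
    unfolding f_def k_def
    by (intro continuous_intros continuous_on_compose2[OF P[of UNIV]] continuous_on_subset[OF g]) auto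
  have z: "integral {0..1} (\<lambda>x. h x * f n x) = 0" for n
    by (intro null_coeffs_integral[OF h] f_cont) (simp add: f_def k_def)
  have f_lim: "(\<lambda>n. f n x) \<longlonglongrightarrow> cnj (h x)" if x: "x \<in> {0..1} - U" for x
  proof -
    have "isCont P (cnj (h x))"
      using P[of UNIV] by (simp add: continuous_on_eq_continuous_at)
    moreover have "(\<lambda>n. g n x) \<longlonglongrightarrow> cnj (h x)"
      using lim[of x] x by (simp add: U_def)
    ultimately have "(\<lambda>n. P (g n x)) \<longlonglongrightarrow> P (cnj (h x))"
      by (rule isCont_tendsto_compose)
    moreover have "P (cnj (h x)) = cnj (h x)"
      using K(2) x by (intro P_id) auto
    moreover have "(\<lambda>n. of_real (k n x) :: complex) \<longlonglongrightarrow> 1"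
    proof (rule tendsto_eventually)
      have m: "min x (1 - x) > 0"
        using x by (auto simp: U_def)
      obtain n0 :: nat where n0: "real n0 > 1 / min x (1 - x)"
        using reals_Archimedean2 by blast
      show "\<forall>\<^sub>F n in sequentially. of_real (k n x) = (1::complex)"
        using eventually_ge_at_top[of n0]
      proof eventually_elim
        case (elim n)
        then have "real n > 1 / min x (1 - x)"
          using n0 by linarith
        then have "real n * min x (1 - x) > 1"
          using m by (simp add: pos_divide_less_eq)
        then show ?case
          by (simp add: k_def)
      qed
    qed
    ultimately show ?thesis
      unfolding f_def using tendsto_mult[of "\<lambda>n. P (g n x)" "cnj (h x)"] by fastforce
  qed
  have int: "(\<lambda>x. h x * f n x) integrable_on {0..1}" for n
    by (intro bounded_mult_continuous(3)[OF h'] f_cont)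
  \<comment> \<open>The exceptional set is overwritten by 0 because the dominated convergence rule
    demands convergence at every point.\<close>
  define D where "D x = (if x \<in> U then 0 else (cmod (h x))\<^sup>2)" for x
  have conv: "(\<lambda>n. (if x \<in> U then 0 else h x * f n x)) \<longlonglongrightarrow> of_real (D x)" if "x \<in> {0..1}" for x
    using that f_lim[of x] tendsto_mult_left[of "\<lambda>n. f n x" "cnj (h x)" sequentially "h x"]
    by (auto simp: D_def complex_norm_square simp flip: of_real_power)
  have int': "(\<lambda>x. if x \<in> U then 0 else h x * f n x) integrable_on {0..1}" for n
    by (rule integrable_spike[OF int U]) auto
  have le: "norm (if x \<in> U then 0 else h x * f n x) \<le> K * K" if "x \<in> {0..1}" for n x
  proof -
    have "\<bar>k n x\<bar> \<le> 1"
      using that by (auto simp: k_def)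
    then have "norm (f n x) \<le> K * 1"
      unfolding f_def norm_mult using P_le K(1) by (intro mult_mono) auto
    then have "norm (h x * f n x) \<le> K * K"
      unfolding norm_mult using K that by (intro mult_mono) auto
    then show ?thesis using K by auto
  qed
  have "(\<lambda>n. integral {0..1} (\<lambda>x. if x \<in> U then 0 else h x * f n x)) \<longlonglongrightarrow> integral {0..1} (\<lambda>x. of_real (D x) :: complex)"
    and D_int: "(\<lambda>x. of_real (D x) :: complex) integrable_on {0..1}"
    using dominated_convergence[where h = "\<lambda>_. K * K", OF int' _ le conv] by auto
  moreover have "integral {0..1} (\<lambda>x. if x \<in> U then 0 else h x * f n x) = 0" for n
    using integral_spike[OF U, of "{0..1}" "\<lambda>x. h x * f n x" "\<lambda>x. if x \<in> U then 0 else h x * f n x"] z[of n]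
    by auto
  ultimately have "integral {0..1} (\<lambda>x. of_real (D x) :: complex) = 0"
    by (simp add: LIMSEQ_const_iff)
  moreover have D_int': "D integrable_on {0..1}"
    using integrable_linear[OF D_int bounded_linear_Re] by (simp add: o_def)
  ultimately have D0: "integral {0..1} D = 0"
    using integral_linear[OF D_int' bounded_linear_of_real[where 'a = complex]] by (simp add: o_def)
  have abs: "integrable (lebesgue_on {0..1}) D"
    using nonnegative_absolutely_integrable_1[OF D_int'] by (subst integrable_restrict_space) (auto simp: D_def set_integrable_def)
  have "integral\<^sup>L (lebesgue_on {0..1}) D = 0"
    using lebesgue_integral_eq_integral[OF abs] D0 by simp
  then have "AE x in lebesgue_on {0..1}. D x = 0"
    using integral_nonneg_eq_0_iff_AE[OF abs] by (simp add: D_def)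
  then have "AE x in lebesgue. x \<in> {0..1} \<longrightarrow> D x = 0"
    by (subst (asm) AE_restrict_space_iff) auto
  then obtain V where V: "{x. \<not> (x \<in> {0..1} \<longrightarrow> D x = 0)} \<subseteq> V" "V \<in> null_sets lebesgue"
    by (auto simp: eventually_ae_filter)
  have "negligible (U \<union> V)"
    using U V(2) by (auto simp: negligible_iff_null_sets)
  then show ?thesis
    by (rule negligible_subset) (use V(1) in \<open>auto simp: D_def\<close>)
qed

text \<open>The difference of the two sides has vanishing coefficients and is continuous on the
  circle. This version inverts the Zak transform at a fixed \<open>\<xi>\<close>.\<close>

lemma fourier_series_eq:
  assumes f: "continuous_on {0..1} f" "f 0 = f 1"
    and c: "\<And>n. norm (c n) \<le> A * exp (- a * \<bar>of_int n\<bar>)" and a: "a > 0"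
    and coeff: "\<And>n::int. integral {0..1} (\<lambda>x. f x * ez (- of_int n * of_real x)) = c n"
    and x: "x \<in> {0..1::real}"
  shows "f x = trig_series c (of_real x)"
proof -
  define h where "h x = f x - trig_series c (of_real x)" for x :: real
  have t: "continuous_on {0..1} (\<lambda>x::real. trig_series c (of_real x))"
    using trig_series_continuous_real[OF c a] by (rule continuous_on_subset) auto
  have h: "continuous_on {0..1} h"
    unfolding h_def using f t by (intro continuous_intros)
  have "integral {0..1} (\<lambda>x. h x * ez (of_int n * of_real x)) = 0" for n
  proof -
    have 1: "(\<lambda>x. f x * ez (- of_int (- n) * of_real x)) integrable_on {0..1}"
      and 2: "(\<lambda>x::real. trig_series c (of_real x) * ez (- of_int (- n) * of_real x)) integrable_on {0..1}"
      by (intro integrable_continuous_real continuous_intros f t)+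
    show ?thesis
      using integral_diff[OF 1 2] coeff[of "- n"] trig_series_coeff[OF c a, of "- n"]
      by (simp add: h_def left_diff_distrib)
  qed
  moreover have "bounded (h ` {0..1})"
    by (intro compact_imp_bounded compact_continuous_image h) auto
  ultimately have "null_coeffs h"
    using continuous_imp_measurable_on_sets_lebesgue[OF h] by (simp add: null_coeffs_def)
  moreover have "h 0 = h 1"
    using f(2) trig_series_add_1[of c 0] by (simp add: h_def)
  ultimately have "h x = 0"
    using h x by (intro null_coeffs_continuous_eq_0) auto
  then show ?thesis by (simp add: h_def)
qed


text \<open>The same difference argument with uniqueness up to null sets; it serves the Poisson
  formula, where \<open>g\<close> is merely measurable.\<close>

lemma fourier_series_ae_eq:
  assumes f: "f \<in> borel_measurable (lebesgue_on {0..1})" "bounded (f ` {0..1})"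
    and c: "\<And>n. norm (c n) \<le> A * exp (- a * \<bar>of_int n\<bar>)" and a: "a > 0"
    and coeff: "\<And>n::int. integral {0..1} (\<lambda>x. f x * ez (- of_int n * of_real x)) = c n"
  shows "negligible {x \<in> {0..1::real}. f x \<noteq> trig_series c (of_real x)}"
proof -
  define h where "h x = f x - trig_series c (of_real x)" for x :: real
  have t: "continuous_on {0..1} (\<lambda>x::real. trig_series c (of_real x))"
    using trig_series_continuous_real[OF c a] by (rule continuous_on_subset) auto
  have t': "bounded ((\<lambda>x::real. trig_series c (of_real x)) ` {0..1})"
    by (intro compact_imp_bounded compact_continuous_image t) auto
  have "integral {0..1} (\<lambda>x. h x * ez (of_int n * of_real x)) = 0" for n
  proof -
    have 1: "(\<lambda>x. f x * ez (- of_int (- n) * of_real x)) integrable_on {0..1}"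
      by (intro bounded_mult_continuous(3)[OF f] continuous_intros)
    have 2: "(\<lambda>x::real. trig_series c (of_real x) * ez (- of_int (- n) * of_real x)) integrable_on {0..1}"
      by (intro integrable_continuous_real continuous_intros t)
    show ?thesis
      using integral_diff[OF 1 2] coeff[of "- n"] trig_series_coeff[OF c a, of "- n"]
      by (simp add: h_def left_diff_distrib)
  qed
  moreover have "bounded (h ` {0..1})"
    unfolding h_def using bounded_minus_comp[OF f(2) t'] by simp
  moreover have "h \<in> borel_measurable (lebesgue_on {0..1})"
    unfolding h_def using f(1) continuous_imp_measurable_on_sets_lebesgue[OF t]
    by (intro borel_measurable_diff) auto
  ultimately have "null_coeffs h"
    by (simp add: null_coeffs_def)
  from null_coeffs_negligible[OF this] show ?thesis
    by (simp add: h_def)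
qed

subsection \<open>Unfolding integrals over the real line\<close>

text \<open>Unconditional sums become limits of sequences, the form in which dominated convergence
  and measurability of limits apply.\<close>

lemma filterlim_symmetric_int_intervals:
  "filterlim (\<lambda>n. {- int n..int n}) (finite_subsets_at_top UNIV) sequentially"
  unfolding filterlim_finite_subsets_at_top
proof (intro allI impI)
  fix X :: "int set"
  assume X: "finite X \<and> X \<subseteq> UNIV"
  then have "bdd_above (abs ` X)"
    by (intro bdd_above_finite finite_imageI) simp
  then obtain B where B: "\<And>k. k \<in> X \<Longrightarrow> \<bar>k\<bar> \<le> B"
    unfolding bdd_above_def by blast
  show "\<forall>\<^sub>F n in sequentially. finite {- int n..int n} \<and> X \<subseteq> {- int n..int n} \<and> {- int n..int n} \<subseteq> UNIV"
    using eventually_ge_at_top[of "nat B"]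
  proof eventually_elim
    case (elim n)
    have "k \<in> {- int n..int n}" if "k \<in> X" for k
      using B[OF that] elim by (simp add: abs_le_iff) linarith
    then have "X \<subseteq> {- int n..int n}" by (rule subsetI)
    then show ?case by simp
  qed
qed

lemma infsum_int_LIMSEQ:
  fixes f :: "int \<Rightarrow> 'a::banach"
  assumes "f summable_on UNIV"
  shows "(\<lambda>n. \<Sum>k\<in>{- int n..int n}. f k) \<longlonglongrightarrow> (\<Sum>\<^sub>\<infinity>k. f k)"
proof -
  have "(sum f \<longlongrightarrow> (\<Sum>\<^sub>\<infinity>k. f k)) (finite_subsets_at_top UNIV)"
    using has_sum_infsum[OF assms] by (simp add: has_sum_def)
  from filterlim_compose[OF this filterlim_symmetric_int_intervals] show ?thesis .
qed

lemma lebesgue_measurable_affine: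
  fixes f :: "real \<Rightarrow> 'a::topological_space"
  assumes "f \<in> borel_measurable lebesgue" "a \<noteq> 0"
  shows "(\<lambda>x. f (a * x + b)) \<in> borel_measurable lebesgue"
proof -
  have "(\<lambda>x. b + (\<Sum>j\<in>Basis. (a * (x \<bullet> j)) *\<^sub>R j)) = (\<lambda>x. a * x + b)"
    by (simp add: add.commute)
  moreover have "(\<lambda>x. b + (\<Sum>j\<in>Basis. (a * (x \<bullet> j)) *\<^sub>R j)) \<in> lebesgue \<rightarrow>\<^sub>M lebesgue"
    using assms(2) by (intro lebesgue_affine_measurable)
  ultimately have "(\<lambda>x. a * x + b) \<in> lebesgue \<rightarrow>\<^sub>M lebesgue"
    by simp
  from measurable_compose[OF this assms(1)] show ?thesis .
qed

lemma integrable_exp_abs: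
  fixes a :: real
  assumes "a > 0"
  shows "integrable lebesgue (\<lambda>x::real. exp (- a * \<bar>x\<bar>))"
proof -
  have "set_integrable lebesgue {0..} (\<lambda>x. exp (- a * x))"
    using assms integrable_on_exp_minus_to_infinity[of a 0]
    by (intro nonnegative_absolutely_integrable_1) auto
  then have 1: "integrable lborel (\<lambda>x. indicator {0..} x * exp (- a * x))"
    by (simp add: set_integrable_def integrable_completion)
  have 2: "integrable lborel (\<lambda>x. indicator {0..} (0 + (-1) * x) * exp (- a * (0 + (-1) * x)))"
    by (rule lborel_integrable_real_affine[OF 1]) simp
  have "integrable lborel (\<lambda>x. exp (- a * \<bar>x\<bar>))"
    by (rule Bochner_Integration.integrable_bound[OF Bochner_Integration.integrable_add[OF 1 2]])
      (auto simp: indicator_def)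
  then show ?thesis
    by (simp add: integrable_completion)
qed

lemma lebesgue_integral_exp_bounded:
  fixes f :: "real \<Rightarrow> complex"
  assumes f: "f \<in> borel_measurable lebesgue" and le: "\<And>x. norm (f x) \<le> C * exp (- l * \<bar>x\<bar>)"
    and l: "l > 0"
  shows "integrable lebesgue f" "f integrable_on UNIV" "integral\<^sup>L lebesgue f = integral UNIV f"
proof -
  show int: "integrable lebesgue f"
    by (rule Bochner_Integration.integrable_bound[OF integrable_mult_right[OF integrable_exp_abs[OF l], of C] f])
      (use le in \<open>auto intro: order_trans[OF _ abs_ge_self]\<close>)
  show "f integrable_on UNIV" "integral\<^sup>L lebesgue f = integral UNIV f"
    using integrable_on_lebesgue[OF int] integral_lebesgue[OF int] by simp_all
qed

text \<open>The triangle inequality separates \<open>y\<close> from \<open>k\<close>, so summability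
  in \<open>k\<close> is uniform for bounded \<open>y\<close>.\<close>

lemma exp_abs_shift_le:
  fixes l a :: real
  assumes "l > 0" "a > 0"
  shows "exp (- l * \<bar>a * (y - k)\<bar>) \<le> exp (l * a * \<bar>y\<bar>) * exp (- (l * a) * \<bar>k\<bar>)"
proof -
  have "\<bar>k\<bar> \<le> \<bar>y - k\<bar> + \<bar>y\<bar>" by linarith
  then have "l * a * \<bar>k\<bar> \<le> l * a * (\<bar>y - k\<bar> + \<bar>y\<bar>)"
    using assms by (intro mult_left_mono) auto
  then show ?thesis
    using assms by (simp add: abs_mult distrib_left mult_ac flip: exp_add)
qed

section \<open>Periodization of an exponentially decaying function\<close>

context
  fixes f :: "real \<Rightarrow> complex" and C l a :: real
  assumes f: "f \<in> borel_measurable lebesgue" and f_le: "\<And>x. norm (f x) \<le> C * exp (- l * \<bar>x\<bar>)"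
    and l: "l > 0" and a: "a > 0"
begin

lemma periodization_term_le:
  "norm (f (a * (y - of_int k))) \<le> C * exp (l * a * \<bar>y\<bar>) * exp (- (l * a) * \<bar>of_int k\<bar>)"
proof -
  have "C \<ge> 0" using order_trans[OF norm_ge_zero f_le[of 0]] by simp
  then have "C * exp (- l * \<bar>a * (y - of_int k)\<bar>) \<le> C * (exp (l * a * \<bar>y\<bar>) * exp (- (l * a) * \<bar>of_int k\<bar>))"
    by (intro mult_left_mono exp_abs_shift_le l a)
  then show ?thesis
    using order_trans[OF f_le] by (simp add: mult.assoc)
qed

lemma periodization_majorant:
  "(\<lambda>k::int. K * exp (- (l * a) * \<bar>of_int k\<bar>)) summable_on UNIV"
  using summable_on_exp_abs_int[of "l * a"] l a by (intro summable_on_cmult_right) auto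

lemma periodization_summable: "(\<lambda>k. norm (f (a * (y - of_int k)))) summable_on UNIV"
  by (rule summable_on_comparison_test[OF periodization_majorant periodization_term_le]) auto

lemma periodization_LIMSEQ:
  "(\<lambda>n. \<Sum>k\<in>{- int n..int n}. f (a * (y - of_int k))) \<longlonglongrightarrow> (\<Sum>\<^sub>\<infinity>k. f (a * (y - of_int k)))"
  by (rule infsum_int_LIMSEQ[OF abs_summable_summable[OF periodization_summable]])

lemma periodization_term_measurable: "(\<lambda>y. f (a * (y - b))) \<in> borel_measurable lebesgue"
proof -
  have "(\<lambda>y. f (a * y + - a * b)) \<in> borel_measurable lebesgue"
    using a by (intro lebesgue_measurable_affine f) simp
  then show ?thesis by (simp add: right_diff_distrib)
qed

lemma periodization_measurable: "(\<lambda>y. \<Sum>\<^sub>\<infinity>k. f (a * (y - of_int k))) \<in> borel_measurable lebesgue"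
  by (rule borel_measurable_LIMSEQ_metric[OF _ periodization_LIMSEQ])
    (intro borel_measurable_sum periodization_term_measurable)

text \<open>The bound is free of \<open>n\<close> and \<open>y\<close>, so it is the constant
  majorant for dominated convergence on the unit interval.\<close>

lemma periodization_partial_le:
  assumes "y \<in> {0..1}"
  shows "norm (\<Sum>k\<in>{- int n..int n}. f (a * (y - of_int k)))
     \<le> (\<Sum>\<^sub>\<infinity>k::int. C * exp (l * a) * exp (- (l * a) * \<bar>of_int k\<bar>))"
proof -
  have "C \<ge> 0" using order_trans[OF norm_ge_zero f_le[of 0]] by simp
  have "norm (f (a * (y - of_int k))) \<le> C * exp (l * a) * exp (- (l * a) * \<bar>of_int k\<bar>)" for k
  proof -
    have "l * a * \<bar>y\<bar> \<le> l * a * 1"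
      using assms l a by (intro mult_left_mono) auto
    then have "C * exp (l * a * \<bar>y\<bar>) * exp (- (l * a) * \<bar>of_int k\<bar>) \<le> C * exp (l * a) * exp (- (l * a) * \<bar>of_int k\<bar>)"
      using \<open>C \<ge> 0\<close> by (intro mult_right_mono mult_left_mono) auto
    then show ?thesis
      using periodization_term_le[of y k] by linarith
  qed
  then have "norm (\<Sum>k\<in>{- int n..int n}. f (a * (y - of_int k)))
      \<le> (\<Sum>k\<in>{- int n..int n}. C * exp (l * a) * exp (- (l * a) * \<bar>of_int k\<bar>))"
    by (intro sum_norm_le)
  also have "\<dots> \<le> (\<Sum>\<^sub>\<infinity>k::int. C * exp (l * a) * exp (- (l * a) * \<bar>of_int k\<bar>))"
    using \<open>C \<ge> 0\<close> by (intro finite_sum_le_infsum periodization_majorant) auto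
  finally show ?thesis .
qed

lemma periodization_bounded: "bounded ((\<lambda>y. \<Sum>\<^sub>\<infinity>k. f (a * (y - of_int k))) ` {0..1})"
proof (rule boundedI)
  fix z assume "z \<in> (\<lambda>y. \<Sum>\<^sub>\<infinity>k. f (a * (y - of_int k))) ` {0..1}"
  then obtain y where y: "y \<in> {0..1}" and z: "z = (\<Sum>\<^sub>\<infinity>k. f (a * (y - of_int k)))"
    by blast
  show "norm z \<le> (\<Sum>\<^sub>\<infinity>k::int. C * exp (l * a) * exp (- (l * a) * \<bar>of_int k\<bar>))"
    unfolding z by (rule LIMSEQ_le_const2[OF tendsto_norm[OF periodization_LIMSEQ]])
      (use periodization_partial_le[OF y] in auto)
qed

lemma periodization_piece:
  "((\<lambda>y. f (a * (y - of_int k))) has_integral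
     (integral {- a * of_int k..a * (1 - of_int k)} f / a)) {0..1}"
proof -
  have "f integrable_on cbox (- a * of_int k) (a * (1 - of_int k))"
    using integrable_on_subcbox[OF lebesgue_integral_exp_bounded(2)[OF f f_le l]] by blast
  note has_integral_affinity[OF integrable_integral[OF this], of a "- a * of_int k"]
  moreover have "(\<lambda>x. (1 / a) *\<^sub>R x + - ((1 / a) *\<^sub>R (- a * of_int k))) = (\<lambda>x. x / a + of_int k)"
    using a by auto
  moreover have "(1 / \<bar>a\<bar> ^ DIM(real)) *\<^sub>R J = J / of_real a" for J :: complex
    using a by (simp add: scaleR_conv_of_real)
  ultimately have "((\<lambda>y. f (a * y - a * of_int k)) has_integral
     (integral {- a * of_int k..a * (1 - of_int k)} f / a))
      ((\<lambda>x. x / a + of_int k) ` {- a * of_int k..a * (1 - of_int k)})"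
    using a by simp
  moreover have "(\<lambda>x. x / a + of_int k) ` {- a * of_int k..a * (1 - of_int k)} = {0..1}"
  proof (intro equalityI subsetI)
    fix y :: real assume y: "y \<in> {0..1}"
    show "y \<in> (\<lambda>x. x / a + of_int k) ` {- a * of_int k..a * (1 - of_int k)}"
    proof (rule rev_image_eqI)
      show "a * (y - of_int k) \<in> {- a * of_int k..a * (1 - of_int k)}"
        using a y by (simp add: right_diff_distrib)
    qed (use a in simp)
  next
    fix y assume "y \<in> (\<lambda>x. x / a + of_int k) ` {- a * of_int k..a * (1 - of_int k)}"
    then obtain x where y: "y = x / a + of_int k" and "x \<in> {- a * of_int k..a * (1 - of_int k)}"
      by (rule imageE)
    then have x: "- a * of_int k \<le> x" "x \<le> a * (1 - of_int k)"
      by simp_all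
    have "- of_int k \<le> x / a" "x / a \<le> 1 - of_int k"
      using x a by (simp_all add: pos_le_divide_eq pos_divide_le_eq mult.commute)
    then show "y \<in> {0..1}"
      by (simp add: y)
  qed
  ultimately show ?thesis
    by (simp add: right_diff_distrib)
qed

text \<open>The pieces are adjacent and tile one interval. It is asymmetric because the piece of
  \<open>k = n\<close> begins at \<open>- a * n\<close>, while that of \<open>k = - n\<close> ends
  at \<open>a * (n + 1)\<close>.\<close>

lemma periodization_partial_integral:
  "((\<lambda>y. \<Sum>k\<in>{- int n..int n}. f (a * (y - of_int k))) has_integral
     (integral {- a * n..a * (n + 1)} f / a)) {0..1}"
proof -
  have int: "f integrable_on {u..v}" for u v
    using integrable_on_subcbox[OF lebesgue_integral_exp_bounded(2)[OF f f_le l], of u v] by simp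
  have "(\<Sum>k\<in>{- int n..int n}. integral {- a * of_int k..a * (1 - of_int k)} f)
    = integral {- a * n..a * (n + 1)} f"
  proof (induction n)
    case (Suc n)
    have "{- int (Suc n)..int (Suc n)} = insert (- int (Suc n)) (insert (int (Suc n)) {- int n..int n})"
      by auto
    moreover have "- (a * (- 1 - real n)) = a * (1 + real n)"
      by (simp add: algebra_simps)
    ultimately have "(\<Sum>k\<in>{- int (Suc n)..int (Suc n)}. integral {- a * of_int k..a * (1 - of_int k)} f)
      = integral {- a * Suc n..- a * n} f + (integral {- a * n..a * (n + 1)} f + integral {a * (n + 1)..a * (Suc n + 1)} f)"
      using Suc.IH by (simp add: add_ac)
    also have "integral {- a * n..a * (n + 1)} f + integral {a * (n + 1)..a * (Suc n + 1)} f
       = integral {- a * n..a * (Suc n + 1)} f"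
      using a by (intro Henstock_Kurzweil_Integration.integral_combine int) (auto simp: algebra_simps)
    also have "integral {- a * Suc n..- a * n} f + \<dots> = integral {- a * Suc n..a * (Suc n + 1)} f"
      using a by (intro Henstock_Kurzweil_Integration.integral_combine int) (auto simp: algebra_simps)
    finally show ?case .
  qed simp
  then show ?thesis
    using has_integral_sum[of "{- int n..int n}" "\<lambda>k y. f (a * (y - of_int k))", OF _ periodization_piece]
    by (simp flip: sum_divide_distrib)
qed

text \<open>Up to the factor \<open>a\<close>, both sides are limits of the same integrals over
  \<open>?I n\<close>. Dominated convergence is used twice: with a constant majorant on
  \<open>[0, 1]\<close>, and with the exponential majorant of \<open>f\<close> on the line.\<close>

lemma integral_eq_integral_periodization:
  "integral UNIV f = of_real a * integral {0..1} (\<lambda>y. \<Sum>\<^sub>\<infinity>k. f (a * (y - of_int k)))"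
proof -
  let ?I = "\<lambda>n. {- a * real n..a * (real n + 1)}"
  have "(\<lambda>n. integral {0..1} (\<lambda>y. \<Sum>k\<in>{- int n..int n}. f (a * (y - of_int k))))
     \<longlonglongrightarrow> integral {0..1} (\<lambda>y. \<Sum>\<^sub>\<infinity>k. f (a * (y - of_int k)))"
    by (rule dominated_convergence(2)[OF has_integral_integrable[OF periodization_partial_integral]
          integrable_const_ivl periodization_partial_le periodization_LIMSEQ])
  then have 1: "(\<lambda>n. integral (?I n) f / a) \<longlonglongrightarrow> integral {0..1} (\<lambda>y. \<Sum>\<^sub>\<infinity>k. f (a * (y - of_int k)))"
    by (simp add: integral_unique[OF periodization_partial_integral] add.commute)
  have "(\<lambda>n. integral UNIV (\<lambda>x. if x \<in> ?I n then f x else 0)) \<longlonglongrightarrow> integral UNIV f"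
  proof (rule dominated_convergence(2))
    show "(\<lambda>x. C * exp (- l * \<bar>x\<bar>)) integrable_on UNIV"
      by (intro integrable_on_lebesgue integrable_mult_right integrable_exp_abs l)
    show "(\<lambda>x. if x \<in> ?I n then f x else 0) integrable_on UNIV" for n
      using integrable_on_subcbox[OF lebesgue_integral_exp_bounded(2)[OF f f_le l], of "- a * n" "a * (n + 1)"]
      by (subst integrable_restrict_UNIV) (simp add: add.commute)
    show "norm (if x \<in> ?I n then f x else 0) \<le> C * exp (- l * \<bar>x\<bar>)" for n x
      using f_le[of x] order_trans[OF norm_ge_zero f_le[of x]] by auto
    show "(\<lambda>n. if x \<in> ?I n then f x else 0) \<longlonglongrightarrow> f x" for x
    proof (rule tendsto_eventually)
      obtain n0 :: nat where n0: "\<bar>x\<bar> / a \<le> real n0"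
        using real_arch_simple by blast
      show "\<forall>\<^sub>F n in sequentially. (if x \<in> ?I n then f x else 0) = f x"
        using eventually_ge_at_top[of n0]
      proof eventually_elim
        case (elim n)
        then have "\<bar>x\<bar> / a \<le> real n" using n0 by linarith
        then have "\<bar>x\<bar> \<le> a * real n" using a by (simp add: pos_divide_le_eq mult.commute)
        then have "x \<in> ?I n" using a by (auto simp: distrib_left)
        then show ?case by simp
      qed
    qed
  qed
  then have "(\<lambda>n. integral (?I n) f) \<longlonglongrightarrow> integral UNIV f"
    by (simp only: integral_restrict_UNIV)
  then have "(\<lambda>n. integral (?I n) f / of_real a) \<longlonglongrightarrow> integral UNIV f / of_real a"
    by (intro tendsto_divide tendsto_const) (use a in auto)
  with 1 have "integral UNIV f / of_real a = integral {0..1} (\<lambda>y. \<Sum>\<^sub>\<infinity>k. f (a * (y - of_int k)))"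
    using LIMSEQ_unique by blast
  then show ?thesis
    using a by (simp add: field_simps)
qed

end

subsection \<open>The normalized Zak transform\<close>

lemma zak_eq_trig_series:
  "zak \<beta> f x \<xi> = trig_series (\<lambda>k. of_real (1 / sqrt \<beta>) * f (inverse \<beta> * (\<xi> - of_int k))) (of_real x)"
  unfolding zak_def trig_series_def ez_def
  by (subst infsum_cmult_right' [symmetric]) (simp add: mult.assoc)

lemma trig_series_add_int: "trig_series c (z + of_int j) = trig_series c z"
  by (simp add: trig_series_def distrib_left ez_add flip: of_int_mult)

lemma zak_add_int: "zak \<beta> f (x + of_int j) \<xi> = zak \<beta> f x \<xi>"
  by (simp add: zak_eq_trig_series trig_series_add_int)

text \<open>Replacing \<open>k\<close> by \<open>k + j\<close> in the sum produces the phase. Its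
  modulus is one, so the modulus of the Zak transform has period 1 in \<open>\<xi>\<close>.\<close>

lemma zak_quasi_periodic: "zak \<beta> f x (\<xi> - of_int j) = ez (- of_int j * of_real x) * zak \<beta> f x \<xi>"
proof -
  let ?h = "\<lambda>k. of_real (1 / sqrt \<beta>) * f (inverse \<beta> * (\<xi> - of_int k)) * ez (of_int k * of_real x)"
  have "zak \<beta> f x (\<xi> - of_int j) =
    (\<Sum>\<^sub>\<infinity>k. of_real (1 / sqrt \<beta>) * f (inverse \<beta> * (\<xi> - of_int j - of_int k)) * ez (of_int k * of_real x))"
    by (simp add: zak_eq_trig_series trig_series_def)
  also have "\<dots> = (\<Sum>\<^sub>\<infinity>k. ez (- of_int j * of_real x) * ?h (k + j))"
  proof (rule infsum_cong)
    fix k :: int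
    have "ez (of_int k * of_real x) = ez (- of_int j * of_real x) * ez (of_int (k + j) * of_real x)"
      by (simp add: distrib_right flip: ez_add)
    then show "of_real (1 / sqrt \<beta>) * f (inverse \<beta> * (\<xi> - of_int j - of_int k)) * ez (of_int k * of_real x)
        = ez (- of_int j * of_real x) * ?h (k + j)"
      by (simp add: mult_ac diff_diff_eq add.commute)
  qed
  also have "\<dots> = (\<Sum>\<^sub>\<infinity>k. ez (- of_int j * of_real x) * ?h k)"
    by (rule infsum_reindex_bij_betw[of "\<lambda>k. k + j" UNIV UNIV "\<lambda>k. ez (- of_int j * of_real x) * ?h k"])
      (rule bij_betwI[where g = "\<lambda>k. k - j"]; simp)
  also have "\<dots> = ez (- of_int j * of_real x) * (\<Sum>\<^sub>\<infinity>k. ?h k)"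
    by (rule infsum_cmult_right')
  finally show ?thesis
    by (simp add: zak_eq_trig_series trig_series_def)
qed

text \<open>With real samples, conjugation acts only on the exponentials and reverses the sign of
  \<open>x\<close>.\<close>

lemma cnj_zak_real: "cnj (zak \<beta> (\<lambda>x. of_real (f x)) x \<xi>) = zak \<beta> (\<lambda>x. of_real (f x)) (- x) \<xi>"
  by (simp add: zak_eq_trig_series trig_series_def cnj_ez flip: infsum_cnj)

lemma real_frac_decomp: "\<xi> = frac \<xi> - of_int (- \<lfloor>\<xi>\<rfloor>)" "frac \<xi> \<in> {0..1}" for \<xi> :: real
  using frac_ge_0[of \<xi>] frac_lt_1[of \<xi>] by (auto simp: frac_def)

text \<open>Here \<open>\<delta>\<close> plays the part of the infimum. The lower bound is assumed
  on the unit square; periodicity carries it to the plane in \<open>energy_ge\<close>.\<close>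

locale zak_window =
  fixes \<beta> C l m \<delta> :: real and N :: nat and g :: "real \<Rightarrow> real"
  assumes beta: "\<beta> > 0" "inverse \<beta> = real N"
    and pos: "C > 0" "l > 0" "m > 0" "\<delta> > 0"
    and g_meas: "g \<in> borel_measurable lebesgue"
    and g_decay: "\<And>x. \<bar>g x\<bar> \<le> C * exp (- l * \<bar>x\<bar>)"
    and ghat_decay: "\<And>\<xi>. cmod (fourier (\<lambda>x. of_real (g x)) \<xi>) \<le> C * exp (- m * \<bar>\<xi>\<bar>)"
    and energy_unit: "\<And>x \<xi>. x \<in> {0..1} \<Longrightarrow> \<xi> \<in> {0..1} \<Longrightarrow>
      \<delta> \<le> (\<Sum>r<N. (cmod (zak \<beta> (\<lambda>x. of_real (g x)) x (\<xi> - \<beta> * real r)))\<^sup>2)"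
begin

definition G :: "real \<Rightarrow> real \<Rightarrow> complex" where
  "G = zak \<beta> (\<lambda>x. of_real (g x))"

definition energy :: "real \<Rightarrow> real \<Rightarrow> real" where
  "energy x \<xi> = (\<Sum>r<N. (cmod (G x (\<xi> - \<beta> * real r)))\<^sup>2)"

definition \<Psi> :: "real \<Rightarrow> real \<Rightarrow> complex" where
  "\<Psi> x \<xi> = of_real (1 / sqrt \<beta>) * (G x \<xi> / of_real (sqrt (energy x \<xi>)))"

definition \<phi>hat :: "real \<Rightarrow> complex" where
  "\<phi>hat = inv_zak \<beta> \<Psi>"

lemma N_pos: "N > 0"
proof -
  have "real N > 0"
    unfolding beta(2) [symmetric] using beta(1) by simp
  then show ?thesis by simp
qed

lemma inverse_beta_pos: "inverse \<beta> > 0"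
  using beta(1) by simp

lemma beta_N: "\<beta> * real N = 1"
  using beta by (simp flip: beta(2))

lemma energy_add_int: "energy (x + of_int j) \<xi> = energy x \<xi>"
  by (simp add: energy_def G_def zak_add_int)

lemma norm_G_diff_int: "cmod (G x (\<xi> - of_int j)) = cmod (G x \<xi>)"
  by (simp add: G_def zak_quasi_periodic norm_mult)

lemma energy_diff_int: "energy x (\<xi> - of_int j) = energy x \<xi>"
proof -
  have "cmod (G x (\<xi> - of_int j - \<beta> * real r)) = cmod (G x (\<xi> - \<beta> * real r))" for r
    using norm_G_diff_int[of x "\<xi> - \<beta> * real r" j] by (simp add: algebra_simps)
  then show ?thesis by (simp add: energy_def)
qed

text \<open>A shift by \<open>\<beta>\<close> permutes the summands cyclically: each moves to the
  next, and the one that leaves the range has modulus equal to the first since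
  \<open>\<beta> * N = 1\<close> is a full period.\<close>

lemma energy_diff_beta: "energy x (\<xi> - \<beta> * real r) = energy x \<xi>"
proof (induction r)
  case (Suc r)
  define f where "f i = (cmod (G x (\<xi> - \<beta> * real r - \<beta> * real i)))\<^sup>2" for i
  have "f N = f 0"
    using norm_G_diff_int[of x "\<xi> - \<beta> * real r" 1] by (simp add: f_def beta_N)
  then have "(\<Sum>i<N. f (Suc i)) = (\<Sum>i<N. f i)"
    using sum.lessThan_Suc_shift[of f N] by simp
  then have "energy x (\<xi> - \<beta> * real (Suc r)) = energy x (\<xi> - \<beta> * real r)"
    by (simp add: energy_def f_def algebra_simps)
  then show ?case using Suc.IH by simp
qed simp

lemma energy_ge: "\<delta> \<le> energy x \<xi>"
proof -
  have "energy x \<xi> = energy (frac x + of_int \<lfloor>x\<rfloor>) (frac \<xi> - of_int (- \<lfloor>\<xi>\<rfloor>))"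
    by (simp add: frac_def)
  also have "\<dots> = energy (frac x) (frac \<xi>)"
    by (simp only: energy_add_int energy_diff_int)
  also have "\<delta> \<le> \<dots>"
    using energy_unit[OF real_frac_decomp(2)[of x] real_frac_decomp(2)[of \<xi>]]
    by (simp add: energy_def G_def)
  finally show ?thesis .
qed

lemma energy_pos: "energy x \<xi> > 0"
  using energy_ge[of x \<xi>] pos by linarith

lemma \<Psi>_add_int: "\<Psi> (x + of_int j) \<xi> = \<Psi> x \<xi>"
  by (simp add: \<Psi>_def energy_add_int) (simp add: G_def zak_add_int)

lemma \<Psi>_diff_int: "\<Psi> x (\<xi> - of_int j) = ez (- of_int j * of_real x) * \<Psi> x \<xi>"
  by (simp add: \<Psi>_def energy_diff_int) (simp add: G_def zak_quasi_periodic)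

text \<open>The reflection is written \<open>1 - x\<close> rather than \<open>- x\<close>, which
  period 1 allows, since it maps the interval of integration to itself.\<close>

lemma cnj_\<Psi>: "cnj (\<Psi> x \<xi>) = \<Psi> (1 - x) \<xi>"
proof -
  have G: "cnj (G x \<xi>) = G (1 - x) \<xi>" for \<xi>
    using zak_add_int[of \<beta> "\<lambda>x. of_real (g x)" "- x" 1 \<xi>] by (simp add: G_def cnj_zak_real)
  then have "energy (1 - x) \<xi> = energy x \<xi>"
    unfolding energy_def by (metis complex_mod_cnj)
  with G show ?thesis by (simp add: \<Psi>_def)
qed

text \<open>By \<open>energy_diff_beta\<close> all summands share one denominator, and the
  numerators add up to it.\<close>

lemma sum_norm_\<Psi>: "(\<Sum>r<N. (cmod (\<Psi> x (\<xi> - \<beta> * real r)))\<^sup>2) = 1 / \<beta>"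
proof -
  have "(cmod (\<Psi> x (\<xi> - \<beta> * real r)))\<^sup>2 = 1 / \<beta> * ((cmod (G x (\<xi> - \<beta> * real r)))\<^sup>2 / energy x \<xi>)" for r
    using energy_pos[of x \<xi>] beta(1)
    by (simp add: \<Psi>_def energy_diff_beta norm_mult norm_divide power_mult_distrib power_divide)
  then have "(\<Sum>r<N. (cmod (\<Psi> x (\<xi> - \<beta> * real r)))\<^sup>2) = 1 / \<beta> * (energy x \<xi> / energy x \<xi>)"
    by (simp only: sum_distrib_left [symmetric] sum_divide_distrib [symmetric] energy_def [symmetric])
  then show ?thesis
    using energy_pos[of x \<xi>] by simp
qed

text \<open>These are the Fourier coefficients of \<open>G\<close> in the first variable, with
  \<open>\<xi>\<close> frozen.\<close>

definition zc :: "real \<Rightarrow> int \<Rightarrow> complex" where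
  "zc \<xi> k = of_real (1 / sqrt \<beta>) * of_real (g (inverse \<beta> * (\<xi> - of_int k)))"

lemma G_eq_trig_series: "G x \<xi> = trig_series (zc \<xi>) (of_real x)"
  by (simp add: G_def zak_eq_trig_series zc_def[abs_def])

lemma norm_zc_le:
  assumes "\<bar>\<xi>\<bar> \<le> R"
  shows "norm (zc \<xi> k) \<le> C / sqrt \<beta> * exp (l * inverse \<beta> * R) * exp (- (l * inverse \<beta>) * \<bar>of_int k\<bar>)"
proof -
  have "\<bar>g (inverse \<beta> * (\<xi> - of_int k))\<bar> \<le> C * exp (- l * \<bar>inverse \<beta> * (\<xi> - of_int k)\<bar>)"
    by (rule g_decay)
  also have "\<dots> \<le> C * (exp (l * inverse \<beta> * \<bar>\<xi>\<bar>) * exp (- (l * inverse \<beta>) * \<bar>of_int k\<bar>))"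
    using pos inverse_beta_pos by (intro mult_left_mono exp_abs_shift_le) auto
  also have "\<dots> \<le> C * (exp (l * inverse \<beta> * R) * exp (- (l * inverse \<beta>) * \<bar>of_int k\<bar>))"
    using pos inverse_beta_pos assms by (intro mult_left_mono mult_right_mono) auto
  finally have "\<bar>g (inverse \<beta> * (\<xi> - of_int k))\<bar> / sqrt \<beta>
      \<le> C * (exp (l * inverse \<beta> * R) * exp (- (l * inverse \<beta>) * \<bar>of_int k\<bar>)) / sqrt \<beta>"
    using beta by (intro divide_right_mono) auto
  moreover have "norm (zc \<xi> k) = \<bar>g (inverse \<beta> * (\<xi> - of_int k))\<bar> / sqrt \<beta>"
    using beta(1) by (simp add: zc_def norm_mult norm_divide)
  ultimately show ?thesis
    by (simp add: mult.assoc)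
qed

lemma l_inverse_beta_pos: "l * inverse \<beta> > 0"
  using pos inverse_beta_pos by simp

lemma G_continuous: "continuous_on A (\<lambda>x. G x \<xi>)"
  unfolding G_eq_trig_series
  using trig_series_continuous_real[OF norm_zc_le[OF order_refl] l_inverse_beta_pos]
  by (rule continuous_on_subset) simp

lemma \<Psi>_continuous: "continuous_on A (\<lambda>x. \<Psi> x \<xi>)"
proof -
  have "continuous_on A (\<lambda>x. energy x \<xi>)"
    unfolding energy_def by (intro continuous_intros G_continuous)
  moreover have "sqrt (energy x \<xi>) \<noteq> 0" for x
    using energy_pos[of x \<xi>] by simp
  ultimately show ?thesis
    unfolding \<Psi>_def by (intro continuous_intros G_continuous) auto
qed

definition \<psi>c :: "real \<Rightarrow> int \<Rightarrow> complex" where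
  "\<psi>c \<xi> n = integral {0..1} (\<lambda>x. \<Psi> x \<xi> * ez (- of_int n * of_real x))"

lemma \<phi>hat_eq_integral: "\<phi>hat w = of_real (sqrt \<beta>) * integral {0..1} (\<lambda>x. \<Psi> x (\<beta> * w))"
  unfolding \<phi>hat_def inv_zak_def
  by (simp add: set_lebesgue_integral_eq_integral(2)[OF absolutely_integrable_continuous_real[OF \<Psi>_continuous]])

text \<open>Moving the second argument of \<open>\<Psi>\<close> by \<open>k\<close> multiplies it by
  \<open>ez (- k * x)\<close>, which is exactly the kernel of the Fourier coefficient of index
  \<open>k\<close>.\<close>

lemma \<phi>hat_eq_coeff: "\<phi>hat (inverse \<beta> * (\<xi> - of_int k)) = of_real (sqrt \<beta>) * \<psi>c \<xi> k"
proof -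
  have "\<beta> * (inverse \<beta> * (\<xi> - of_int k)) = \<xi> - of_int k"
    using beta(1) by simp
  then show ?thesis
    by (simp only: \<phi>hat_eq_integral \<Psi>_diff_int \<psi>c_def mult.commute[of "ez _"])
qed

text \<open>The normalization lemma is applied to the series of \<open>G\<close> at the
  \<open>N\<close> shifts of \<open>\<xi>\<close>. Its constants are fixed before
  \<open>\<xi>\<close>, so the decay is uniform.\<close>

lemma \<psi>c_decay:
  obtains B b where "B > 0" "b > 0"
    "\<And>\<xi> n. \<xi> \<in> {0..1} \<Longrightarrow> norm (\<psi>c \<xi> n) \<le> B * exp (- b * \<bar>of_int n\<bar>)"
proof -
  define a where "a = l * inverse \<beta>"
  define A where "A = C / sqrt \<beta> * exp (l * inverse \<beta> * 1)"
  \<comment> \<open>Adding 1 ensures positivity without a positive lower bound for the infinite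
    sum.\<close>
  define M where "M = A * (\<Sum>\<^sub>\<infinity>k::int. exp (- (a / 2) * \<bar>of_int k\<bar>)) + 1"
  have a: "a > 0" using l_inverse_beta_pos by (simp add: a_def)
  have "A > 0" using pos beta by (simp add: A_def)
  then have M: "M > 0"
    unfolding M_def by (intro add_nonneg_pos mult_nonneg_nonneg infsum_nonneg) auto
  have eta: "a / (4 * pi) > 0" using a by simp
  obtain B b where B: "B > 0" "b > 0"
    "\<And>u n. (\<And>r. r < N \<Longrightarrow> u r holomorphic_on strip (a / (4 * pi))) \<Longrightarrow>
       (\<And>r z. r < N \<Longrightarrow> z \<in> strip (a / (4 * pi)) \<Longrightarrow> u r (z + 1) = u r z) \<Longrightarrow>
       (\<And>r z. r < N \<Longrightarrow> z \<in> strip (a / (4 * pi)) \<Longrightarrow> norm (u r z) \<le> M) \<Longrightarrow>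
       (\<And>x. \<delta> \<le> (\<Sum>r<N. (cmod (u r (of_real x)))\<^sup>2)) \<Longrightarrow>
       norm (integral {0..1::real} (\<lambda>x. u (0::nat) (of_real x) /
         of_real (sqrt (\<Sum>r<N. (cmod (u r (of_real x)))\<^sup>2)) * ez (- of_int n * of_real x)))
         \<le> B * exp (- b * \<bar>of_int n\<bar>)"
    by (rule normalized_coeff_decay[OF N_pos eta M pos(4)]) blast
  show ?thesis
  proof (rule that[of "B / sqrt \<beta>" b])
    show "B / sqrt \<beta> > 0" "b > 0" using B beta by auto
    fix \<xi> :: real and n :: int assume \<xi>: "\<xi> \<in> {0..1}"
    define u where "u r = trig_series (zc (\<xi> - \<beta> * real r))" for r
    have c: "norm (zc (\<xi> - \<beta> * real r) k) \<le> A * exp (- a * \<bar>of_int k\<bar>)" if "r < N" for r k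
    proof -
      have "\<beta> * real r \<le> \<beta> * real N"
        using that beta by (intro mult_left_mono) auto
      moreover have "0 \<le> \<beta> * real r" using beta by simp
      \<comment> \<open>Both \<open>\<xi>\<close> and \<open>\<beta> * r\<close> lie in
        \<open>[0, 1]\<close>, so the choice \<open>R = 1\<close> in \<open>norm_zc_le\<close>
        serves all shifts at once.\<close>
      ultimately have "\<bar>\<xi> - \<beta> * real r\<bar> \<le> 1"
        using \<xi> beta_N by auto
      from norm_zc_le[OF this] show ?thesis by (simp add: A_def a_def)
    qed
    have u_real: "u r (of_real x) = G x (\<xi> - \<beta> * real r)" for r x
      by (simp add: u_def G_eq_trig_series)
    have "norm (integral {0..1} (\<lambda>x. u 0 (of_real x) /
         of_real (sqrt (\<Sum>r<N. (cmod (u r (of_real x)))\<^sup>2)) * ez (- of_int n * of_real x)))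
         \<le> B * exp (- b * \<bar>of_int n\<bar>)"
    proof (rule B(3))
      show "u r holomorphic_on strip (a / (4 * pi))" if "r < N" for r
        unfolding u_def using c[OF that] a by (rule trig_series_holomorphic)
      show "u r (z + 1) = u r z" for r z
        by (simp add: u_def trig_series_add_1)
      show "norm (u r z) \<le> M" if "r < N" "z \<in> strip (a / (4 * pi))" for r z
        using trig_series_bound[OF c[OF that(1)] a, of z] that(2) by (simp add: u_def M_def strip_def)
      show "\<delta> \<le> (\<Sum>r<N. (cmod (u r (of_real x)))\<^sup>2)" for x
        using energy_ge[of x \<xi>] by (simp add: u_real energy_def)
    qed
    moreover have "\<psi>c \<xi> n = of_real (1 / sqrt \<beta>) * integral {0..1} (\<lambda>x. u 0 (of_real x) /
         of_real (sqrt (\<Sum>r<N. (cmod (u r (of_real x)))\<^sup>2)) * ez (- of_int n * of_real x))"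
      unfolding u_real \<psi>c_def \<Psi>_def
      by (subst integral_mult_right [symmetric]) (simp add: energy_def mult.assoc)
    ultimately show "norm (\<psi>c \<xi> n) \<le> B / sqrt \<beta> * exp (- b * \<bar>of_int n\<bar>)"
      using beta(1) by (simp add: norm_mult norm_divide divide_right_mono)
  qed
qed

text \<open>The substitution of \<open>1 - x\<close> for \<open>x\<close> shows, with
  \<open>cnj_\<Psi>\<close>, that the defining integral equals its conjugate.\<close>

lemma \<phi>hat_real: "\<phi>hat w \<in> \<real>"
proof -
  let ?f = "\<lambda>x. \<Psi> x (\<beta> * w)"
  have "(\<lambda>x. (1 / - 1) * x + - ((1 / - 1) * 1)) ` {0..1::real} = {0..1}"
  proof (intro equalityI subsetI)
    fix y :: real assume "y \<in> {0..1}"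
    then show "y \<in> (\<lambda>x. (1 / - 1) * x + - ((1 / - 1) * 1)) ` {0..1::real}"
      by (intro image_eqI[of _ _ "1 - y"]) auto
  qed auto
  then have "((\<lambda>x. ?f (1 - x)) has_integral integral {0..1} ?f) {0..1}"
    using has_integral_affinity01[OF integrable_integral[OF integrable_continuous_real[OF \<Psi>_continuous[of "{0..1}" "\<beta> * w"]]], of "-1" 1]
    by simp
  then have "cnj (integral {0..1} ?f) = integral {0..1} ?f"
    by (simp add: integral_cnj cnj_\<Psi> integral_unique)
  then show ?thesis
    by (simp add: \<phi>hat_eq_integral Reals_cnj_iff)
qed

lemma \<phi>hat_decay:
  obtains B b where "B > 0" "b > 0" "\<And>w. norm (\<phi>hat w) \<le> B * exp (- b * \<bar>w\<bar>)"
proof -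
  obtain B b where B: "B > 0" "b > 0"
    and le: "\<And>\<xi> n. \<xi> \<in> {0..1} \<Longrightarrow> norm (\<psi>c \<xi> n) \<le> B * exp (- b * \<bar>of_int n\<bar>)"
    by (rule \<psi>c_decay) blast
  show ?thesis
  \<comment> \<open>The factor \<open>sqrt \<beta>\<close> comes from
    \<open>\<phi>hat_eq_coeff\<close>, \<open>exp b\<close> pays for replacing
    \<open>\<beta> * w\<close> by an integer at distance at most 1, and the rate is rescaled by
    \<open>\<beta>\<close>.\<close>
  proof (rule that[of "sqrt \<beta> * B * exp b" "b * \<beta>"])
    show "sqrt \<beta> * B * exp b > 0" "b * \<beta> > 0" using B beta by auto
    fix w
    define \<xi> where "\<xi> = frac (\<beta> * w)"
    define n where "n = - \<lfloor>\<beta> * w\<rfloor>"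
    have w: "\<beta> * w = \<xi> - of_int n" and \<xi>: "\<xi> \<in> {0..1}"
      using real_frac_decomp[of "\<beta> * w"] by (auto simp: \<xi>_def n_def)
    have "w = inverse \<beta> * (\<xi> - of_int n)"
      using beta(1) by (simp flip: w)
    then have "\<phi>hat w = of_real (sqrt \<beta>) * \<psi>c \<xi> n"
      using \<phi>hat_eq_coeff by metis
    then have "norm (\<phi>hat w) \<le> sqrt \<beta> * (B * exp (- b * \<bar>of_int n\<bar>))"
      using le[OF \<xi>, of n] beta by (simp add: norm_mult mult_left_mono)
    also have "exp (- b * \<bar>of_int n\<bar>) \<le> exp (b - b * \<beta> * \<bar>w\<bar>)"
    proof -
      have "\<bar>\<beta> * w\<bar> \<le> 1 + \<bar>of_int n\<bar>" using w \<xi> by auto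
      then have "b * \<bar>\<beta> * w\<bar> \<le> b * (1 + \<bar>of_int n\<bar>)"
        using B by (intro mult_left_mono) auto
      then show ?thesis using beta by (simp add: abs_mult algebra_simps)
    qed
    finally show "norm (\<phi>hat w) \<le> sqrt \<beta> * B * exp b * exp (- (b * \<beta>) * \<bar>w\<bar>)"
      using B beta by (simp add: exp_diff exp_minus field_simps)
  qed
qed

text \<open>At fixed \<open>\<xi>\<close> the function \<open>\<Psi>\<close> is continuous in
  \<open>x\<close>, hence equal to its Fourier series, whose coefficients are values of
  \<open>\<phi>hat\<close>. Both sides obey the same quasi-periodicity, which extends the identity
  from the unit square to every point.\<close>

lemma zak_\<phi>hat: "zak \<beta> \<phi>hat x \<xi> = \<Psi> x \<xi>"
proof -
  have unit: "zak \<beta> \<phi>hat x \<xi> = \<Psi> x \<xi>" if x: "x \<in> {0..1}" and \<xi>: "\<xi> \<in> {0..1}" for x \<xi>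
  proof -
    obtain B b where B: "B > 0" "b > 0"
      and le: "\<And>\<xi> n. \<xi> \<in> {0..1} \<Longrightarrow> norm (\<psi>c \<xi> n) \<le> B * exp (- b * \<bar>of_int n\<bar>)"
      by (rule \<psi>c_decay) blast
    have "\<Psi> x \<xi> = trig_series (\<psi>c \<xi>) (of_real x)"
    proof (rule fourier_series_eq[OF \<Psi>_continuous _ le[OF \<xi>] B(2) _ x])
      show "\<Psi> 0 \<xi> = \<Psi> 1 \<xi>"
        using \<Psi>_add_int[of 0 1 \<xi>] by simp
    qed (simp only: \<psi>c_def)
    moreover have "of_real (1 / sqrt \<beta>) * \<phi>hat (inverse \<beta> * (\<xi> - of_int k)) = \<psi>c \<xi> k" for k
      using beta(1) unfolding \<phi>hat_eq_coeff by (simp flip: of_real_mult)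
    ultimately show ?thesis
      by (simp add: zak_eq_trig_series)
  qed
  have "zak \<beta> \<phi>hat x \<xi> = zak \<beta> \<phi>hat (frac x + of_int \<lfloor>x\<rfloor>) (frac \<xi> - of_int (- \<lfloor>\<xi>\<rfloor>))"
    by (simp add: frac_def)
  also have "\<dots> = \<Psi> (frac x + of_int \<lfloor>x\<rfloor>) (frac \<xi> - of_int (- \<lfloor>\<xi>\<rfloor>))"
    by (simp only: zak_quasi_periodic \<Psi>_diff_int zak_add_int \<Psi>_add_int unit real_frac_decomp(2))
  also have "\<dots> = \<Psi> x \<xi>"
    by (simp add: frac_def)
  finally show ?thesis .
qed

subsection \<open>The dual series in the second variable\<close>

text \<open>The factor \<open>sqrt \<beta>\<close> is the \<open>1 / sqrt \<beta>\<close> of the Zak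
  transform times the Jacobian \<open>\<beta>\<close> of the unfolding.\<close>

definition poisson_coeff :: "real \<Rightarrow> int \<Rightarrow> complex" where
  "poisson_coeff x n = of_real (sqrt \<beta>) * fourier (\<lambda>t. of_real (g t)) (\<beta> * (x + of_int n))"

text \<open>The integral of this function over the line is the transform of \<open>g\<close> at
  \<open>\<beta> * s\<close>. Taking \<open>s = x + n\<close> absorbs both the twist and the
  character of index \<open>n\<close>.\<close>

definition modulated :: "real \<Rightarrow> real \<Rightarrow> complex" where
  "modulated s t = of_real (g t) * ez (- of_real (t * (\<beta> * s)))"

lemma modulated_measurable: "modulated s \<in> borel_measurable lebesgue"
proof -
  have "(\<lambda>t::real. ez (- of_real (t * (\<beta> * s)))) \<in> borel_measurable lebesgue"
    using continuous_imp_measurable_on_sets_lebesgue[of UNIV "\<lambda>t::real. ez (- of_real (t * (\<beta> * s)))"]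
    by (simp add: lebesgue_on_UNIV_eq continuous_on_ez continuous_on_minus continuous_on_of_real
        continuous_on_mult_right continuous_on_id)
  moreover have "(\<lambda>t. of_real (g t) :: complex) \<in> borel_measurable lebesgue"
    using g_meas by measurable
  ultimately show ?thesis
    unfolding modulated_def[abs_def] by (intro borel_measurable_times)
qed

lemma norm_modulated_le: "norm (modulated s t) \<le> C * exp (- l * \<bar>t\<bar>)"
  using g_decay[of t] by (simp add: modulated_def norm_mult)

lemma integral_modulated: "integral UNIV (modulated s) = fourier (\<lambda>t. of_real (g t)) (\<beta> * s)"
proof -
  have "fourier (\<lambda>t. of_real (g t)) (\<beta> * s) = integral\<^sup>L lebesgue (modulated s)"
    unfolding fourier_def modulated_def[abs_def] ez_def by (simp add: mult_ac)
  then show ?thesis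
    using lebesgue_integral_exp_bounded(3)[OF modulated_measurable norm_modulated_le pos(2)] by simp
qed

text \<open>Expanding \<open>(\<xi> - k) * (x + n)\<close> leaves the cross term
  \<open>k * n\<close>, an integer, whose exponential is 1.\<close>

lemma G_eq_periodization:
  "G x \<xi> * ez (- of_real (x * \<xi>)) * ez (- of_int n * of_real \<xi>) =
     of_real (1 / sqrt \<beta>) * (\<Sum>\<^sub>\<infinity>k. modulated (x + of_int n) (inverse \<beta> * (\<xi> - of_int k)))"
proof -
  have "modulated (x + of_int n) (inverse \<beta> * (\<xi> - of_int k)) =
     of_real (g (inverse \<beta> * (\<xi> - of_int k))) * ez (of_int k * of_real x) *
     (ez (- of_real (x * \<xi>)) * ez (- of_int n * of_real \<xi>))" for k :: int
  proof -
    have "inverse \<beta> * (\<xi> - of_int k) * (\<beta> * (x + of_int n)) = (\<xi> - of_int k) * (x + of_int n)"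
      using beta(1) by simp
    moreover have "ez (- of_real ((\<xi> - of_int k) * (x + of_int n))) =
      ez (of_int (k * n) + (of_int k * of_real x + (- of_real (x * \<xi>) + - of_int n * of_real \<xi>)))"
      by (rule arg_cong[of _ _ ez]) (simp add: algebra_simps)
    ultimately show ?thesis
      by (simp only: modulated_def ez_add ez_of_int mult_1 mult.assoc)
  qed
  then have "(\<Sum>\<^sub>\<infinity>k. modulated (x + of_int n) (inverse \<beta> * (\<xi> - of_int k))) =
     (\<Sum>\<^sub>\<infinity>k. of_real (g (inverse \<beta> * (\<xi> - of_int k))) * ez (of_int k * of_real x)) *
     (ez (- of_real (x * \<xi>)) * ez (- of_int n * of_real \<xi>))"
    by (simp only: infsum_cmult_left')
  moreover have "G x \<xi> = of_real (1 / sqrt \<beta>) *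
     (\<Sum>\<^sub>\<infinity>k. of_real (g (inverse \<beta> * (\<xi> - of_int k))) * ez (of_int k * of_real x))"
    by (simp add: G_def zak_def ez_def mult.assoc)
  ultimately show ?thesis
    by (simp only: mult.assoc)
qed

lemma norm_poisson_coeff_le:
  assumes "\<bar>x\<bar> \<le> 1"
  shows "norm (poisson_coeff x n) \<le> sqrt \<beta> * C * exp (m * \<beta>) * exp (- (m * \<beta>) * \<bar>of_int n\<bar>)"
proof -
  have "exp (- m * \<bar>\<beta> * (x + of_int n)\<bar>) \<le> exp (m * \<beta> * 1) * exp (- (m * \<beta>) * \<bar>of_int n\<bar>)"
  proof -
    have "exp (- m * \<bar>\<beta> * (x - of_int (- n))\<bar>) \<le> exp (m * \<beta> * \<bar>x\<bar>) * exp (- (m * \<beta>) * \<bar>of_int (- n)\<bar>)"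
      using pos beta by (intro exp_abs_shift_le)
    also have "\<dots> \<le> exp (m * \<beta> * 1) * exp (- (m * \<beta>) * \<bar>of_int (- n)\<bar>)"
      using pos beta assms by (intro mult_right_mono) auto
    finally show ?thesis by simp
  qed
  then have "C * exp (- m * \<bar>\<beta> * (x + of_int n)\<bar>) \<le> C * (exp (m * \<beta> * 1) * exp (- (m * \<beta>) * \<bar>of_int n\<bar>))"
    using pos by (intro mult_left_mono) auto
  then have "cmod (fourier (\<lambda>t. of_real (g t)) (\<beta> * (x + of_int n)))
      \<le> C * (exp (m * \<beta> * 1) * exp (- (m * \<beta>) * \<bar>of_int n\<bar>))"
    by (rule order_trans[OF ghat_decay])
  then have "sqrt \<beta> * cmod (fourier (\<lambda>t. of_real (g t)) (\<beta> * (x + of_int n)))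
      \<le> sqrt \<beta> * (C * (exp (m * \<beta> * 1) * exp (- (m * \<beta>) * \<bar>of_int n\<bar>)))"
    using beta by (intro mult_left_mono) auto
  then show ?thesis
    using beta(1) by (simp add: poisson_coeff_def norm_mult mult.assoc)
qed

lemma m_beta_pos: "m * \<beta> > 0"
  using pos beta by simp

text \<open>
  Poisson summation: by unfolding, the Fourier coefficients of the 1-periodic function
  \<open>\<xi> \<mapsto> G x \<xi> * ez (- x * \<xi>)\<close> are samples of the Fourier transform of \<open>g\<close>.
\<close>

lemma poisson_summation_ae:
  assumes x: "x \<in> {0..1}"
  shows "negligible {\<xi>. G x \<xi> * ez (- of_real (x * \<xi>)) \<noteq> trig_series (poisson_coeff x) (of_real \<xi>)}"
proof -
  let ?P = "\<lambda>\<xi>. G x \<xi> * ez (- of_real (x * \<xi>))"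
  define T where "T = {\<xi> \<in> {0..1}. ?P \<xi> \<noteq> trig_series (poisson_coeff x) (of_real \<xi>)}"
  have P: "?P \<xi> = of_real (1 / sqrt \<beta>) * (\<Sum>\<^sub>\<infinity>k. modulated x (inverse \<beta> * (\<xi> - of_int k)))" for \<xi>
    using G_eq_periodization[of x \<xi> 0] by simp
  have x1: "\<bar>x\<bar> \<le> 1" using x by simp
  note mod = modulated_measurable norm_modulated_le pos(2) inverse_beta_pos
  have "negligible T"
    unfolding T_def
  proof (rule fourier_series_ae_eq[OF _ _ norm_poisson_coeff_le[OF x1] m_beta_pos])
    show "?P \<in> borel_measurable (lebesgue_on {0..1})"
      unfolding P by (intro measurable_restrict_space1 borel_measurable_times borel_measurable_const
          periodization_measurable[OF mod])
    show "bounded (?P ` {0..1})"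
      unfolding P using bounded_scaling[OF periodization_bounded[OF mod], of "1 / sqrt \<beta>" x]
      by (simp add: image_image scaleR_conv_of_real)
    fix n :: int
    have "integral {0..1} (\<lambda>\<xi>. ?P \<xi> * ez (- of_int n * of_real \<xi>)) = of_real (1 / sqrt \<beta>) *
        integral {0..1} (\<lambda>\<xi>. \<Sum>\<^sub>\<infinity>k. modulated (x + of_int n) (inverse \<beta> * (\<xi> - of_int k)))"
      by (simp only: G_eq_periodization integral_mult_right)
    also have "integral {0..1} (\<lambda>\<xi>. \<Sum>\<^sub>\<infinity>k. modulated (x + of_int n) (inverse \<beta> * (\<xi> - of_int k)))
        = of_real \<beta> * fourier (\<lambda>t. of_real (g t)) (\<beta> * (x + of_int n))"
      using integral_eq_integral_periodization[OF mod, of "x + of_int n"] beta(1)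
      by (simp add: integral_modulated field_simps)
    also have "of_real (1 / sqrt \<beta>) * (of_real \<beta> * fourier (\<lambda>t. of_real (g t)) (\<beta> * (x + of_int n)))
        = poisson_coeff x n"
    proof -
      have "1 / sqrt \<beta> * \<beta> = sqrt \<beta>"
        using beta(1) by (simp add: real_div_sqrt)
      then show ?thesis
        unfolding poisson_coeff_def mult.assoc[symmetric] of_real_mult[symmetric] by simp
    qed
    finally show "integral {0..1} (\<lambda>\<xi>. ?P \<xi> * ez (- of_int n * of_real \<xi>)) = poisson_coeff x n" .
  qed
  \<comment> \<open>Both sides have period 1 in \<open>\<xi>\<close>, on the left because the twist
    cancels the phase of \<open>zak_quasi_periodic\<close>; so the exceptional set is covered by
    countably many translates of \<open>T\<close>.\<close>
  then have "negligible (\<Union> (range (\<lambda>j::int. (+) (of_int j) ` T)))"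
    by (intro negligible_countable_Union) (auto intro: negligible_translation)
  then show ?thesis
  proof (rule negligible_subset, intro subsetI)
    fix \<xi> assume "\<xi> \<in> {\<xi>. ?P \<xi> \<noteq> trig_series (poisson_coeff x) (of_real \<xi>)}"
    then have ne: "?P \<xi> \<noteq> trig_series (poisson_coeff x) (of_real \<xi>)" by simp
    define j where "j = \<lfloor>\<xi>\<rfloor>"
    have fr: "frac \<xi> = \<xi> - of_int j" by (simp add: j_def frac_def)
    have "?P (frac \<xi>) = ?P \<xi>"
    proof -
      have "ez (- of_int j * of_real x) * ez (- of_real (x * (\<xi> - of_int j))) = ez (- of_real (x * \<xi>))"
        by (simp add: algebra_simps flip: ez_add)
      then show ?thesis
        unfolding fr G_def zak_quasi_periodic by (simp add: mult_ac)
    qed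
    moreover have "trig_series (poisson_coeff x) (of_real (frac \<xi>)) = trig_series (poisson_coeff x) (of_real \<xi>)"
      using trig_series_add_int[of "poisson_coeff x" "of_real (frac \<xi>)" j] by (simp add: fr)
    ultimately have "frac \<xi> \<in> T"
      using ne real_frac_decomp(2)[of \<xi>] by (simp add: T_def)
    moreover have "\<xi> = of_int j + frac \<xi>" by (simp add: fr)
    ultimately show "\<xi> \<in> \<Union> (range (\<lambda>j::int. (+) (of_int j) ` T))" by blast
  qed
qed

text \<open>The normalization lemma is applied to translates of the Poisson series, which are
  holomorphic although \<open>G\<close> need not be continuous in \<open>\<xi>\<close>. They match
  the twisted \<open>G\<close> off a null set, which the coefficient integral ignores.\<close>

lemma dual_coeff_decay:
  obtains B b where "B > 0" "b > 0"
    "\<And>x n. x \<in> {0..1} \<Longrightarrow>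
       norm (integral {0..1} (\<lambda>\<xi>. \<Psi> x \<xi> * ez (- of_real (x * \<xi>)) * ez (- of_int n * of_real \<xi>)))
         \<le> B * exp (- b * \<bar>of_int n\<bar>)"
proof -
  define a where "a = m * \<beta>"
  define A where "A = sqrt \<beta> * C * exp (m * \<beta>)"
  define M where "M = A * (\<Sum>\<^sub>\<infinity>k::int. exp (- (a / 2) * \<bar>of_int k\<bar>)) + 1"
  have a: "a > 0" using m_beta_pos by (simp add: a_def)
  have "A > 0" using pos beta by (simp add: A_def)
  then have M: "M > 0"
    unfolding M_def by (intro add_nonneg_pos mult_nonneg_nonneg infsum_nonneg) auto
  have eta: "a / (4 * pi) > 0" using a by simp
  obtain B b where B: "B > 0" "b > 0"
    "\<And>u n. (\<And>r. r < N \<Longrightarrow> u r holomorphic_on strip (a / (4 * pi))) \<Longrightarrow>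
       (\<And>r z. r < N \<Longrightarrow> z \<in> strip (a / (4 * pi)) \<Longrightarrow> u r (z + 1) = u r z) \<Longrightarrow>
       (\<And>r z. r < N \<Longrightarrow> z \<in> strip (a / (4 * pi)) \<Longrightarrow> norm (u r z) \<le> M) \<Longrightarrow>
       (\<And>x. \<delta> \<le> (\<Sum>r<N. (cmod (u r (of_real x)))\<^sup>2)) \<Longrightarrow>
       norm (integral {0..1::real} (\<lambda>x. u (0::nat) (of_real x) /
         of_real (sqrt (\<Sum>r<N. (cmod (u r (of_real x)))\<^sup>2)) * ez (- of_int n * of_real x)))
         \<le> B * exp (- b * \<bar>of_int n\<bar>)"
    by (rule normalized_coeff_decay[OF N_pos eta M pos(4)]) blast
  show ?thesis
  proof (rule that[of "B / sqrt \<beta>" b])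
    show "B / sqrt \<beta> > 0" "b > 0" using B beta by auto
    fix x :: real and n :: int assume x: "x \<in> {0..1}"
    then have x1: "\<bar>x\<bar> \<le> 1" by simp
    define d where "d = poisson_coeff x"
    have d: "norm (d k) \<le> A * exp (- a * \<bar>of_int k\<bar>)" for k
      using norm_poisson_coeff_le[OF x1, of k] by (simp add: d_def A_def a_def)
    define u where "u r z = trig_series d (z - of_real (\<beta> * real r))" for r z
    define bad where "bad = {\<xi>. G x \<xi> * ez (- of_real (x * \<xi>)) \<noteq> trig_series d (of_real \<xi>)}"
    \<comment> \<open>Each of the \<open>N\<close> shifts needs its own exceptional set; a finite
      union remains negligible.\<close>
    define bads where "bads = (\<Union>r\<in>{..<N}. (+) (\<beta> * real r) ` bad)"
    have bads: "negligible bads"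
      unfolding bads_def bad_def d_def
      by (intro negligible_Union finite_imageI finite_lessThan)
        (elim imageE, simp only:, intro negligible_translation poisson_summation_ae[OF x])
    have good: "u r (of_real \<xi>) = G x (\<xi> - \<beta> * real r) * ez (- of_real (x * (\<xi> - \<beta> * real r)))"
      if "\<xi> \<notin> bads" "r < N" for r \<xi>
    proof -
      have "\<xi> - \<beta> * real r \<notin> bad"
      proof
        assume "\<xi> - \<beta> * real r \<in> bad"
        then have "\<beta> * real r + (\<xi> - \<beta> * real r) \<in> (+) (\<beta> * real r) ` bad" by (rule imageI)
        with that show False by (auto simp: bads_def)
      qed
      then show ?thesis by (simp add: bad_def u_def)
    qed
    have energy: "(\<Sum>r<N. (cmod (u r (of_real \<xi>)))\<^sup>2) = energy x \<xi>" if "\<xi> \<notin> bads" for \<xi>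
      unfolding energy_def using good[OF that] by (intro sum.cong) (auto simp: norm_mult)
    have in_strip: "z - of_real (\<beta> * real r) \<in> strip (a / (4 * pi))" if "z \<in> strip (a / (4 * pi))" for z r
      using that by (simp add: strip_def)
    have holo: "u r holomorphic_on strip (a / (4 * pi))" for r
    proof -
      have "trig_series d \<circ> (\<lambda>z. z - of_real (\<beta> * real r)) holomorphic_on strip (a / (4 * pi))"
        by (rule holomorphic_on_compose_gen[OF _ trig_series_holomorphic[OF d a]])
          (use in_strip in \<open>auto intro!: holomorphic_intros\<close>)
      then show ?thesis by (simp add: u_def[abs_def] o_def)
    qed
    \<comment> \<open>Off \<open>bads\<close> the sum is the energy. The set where it falls below
      \<open>\<delta>\<close> is open by continuity and contained in a null set, hence
      empty.\<close>
    have low: "\<delta> \<le> (\<Sum>r<N. (cmod (u r (of_real \<xi>)))\<^sup>2)" for \<xi>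
    proof (rule ccontr)
      let ?F = "\<lambda>\<xi>::real. \<Sum>r<N. (cmod (u r (of_real \<xi>)))\<^sup>2"
      assume "\<not> ?thesis"
      then have "\<xi> \<in> {\<xi>. ?F \<xi> < \<delta>}" by (simp add: not_le)
      then have ne: "{\<xi>. ?F \<xi> < \<delta>} \<noteq> {}" by blast
      have u_cont: "continuous_on UNIV (\<lambda>\<xi>::real. u r (of_real \<xi>))" for r
        by (rule continuous_on_compose2[OF holomorphic_on_imp_continuous_on[OF holo]])
          (use a in \<open>auto simp: strip_def intro!: continuous_intros\<close>)
      have "open {\<xi>. ?F \<xi> < \<delta>}"
        by (intro open_Collect_less continuous_intros u_cont)
      moreover have "{\<xi>. ?F \<xi> < \<delta>} \<subseteq> bads"
      proof (rule subsetI, rule ccontr)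
        fix \<xi> assume "\<xi> \<in> {\<xi>. ?F \<xi> < \<delta>}" "\<xi> \<notin> bads"
        then show False
          using energy[of \<xi>] energy_ge[of x \<xi>] by simp
      qed
      ultimately show False
        using open_not_negligible[OF _ ne] negligible_subset[OF bads] by blast
    qed
    have "norm (integral {0..1} (\<lambda>\<xi>. u 0 (of_real \<xi>) /
         of_real (sqrt (\<Sum>r<N. (cmod (u r (of_real \<xi>)))\<^sup>2)) * ez (- of_int n * of_real \<xi>)))
         \<le> B * exp (- b * \<bar>of_int n\<bar>)"
    proof (rule B(3))
      show "u r (z + 1) = u r z" for r z
        using trig_series_add_1[of d "z - of_real (\<beta> * real r)"] by (simp add: u_def algebra_simps)
      show "norm (u r z) \<le> M" if "z \<in> strip (a / (4 * pi))" for r z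
        using trig_series_bound[OF d a, of "z - of_real (\<beta> * real r)"] in_strip[OF that, of r]
        by (simp add: u_def M_def strip_def)
    qed (use holo low in auto)
    moreover have "integral {0..1} (\<lambda>\<xi>. \<Psi> x \<xi> * ez (- of_real (x * \<xi>)) * ez (- of_int n * of_real \<xi>)) =
       of_real (1 / sqrt \<beta>) * integral {0..1} (\<lambda>\<xi>. u 0 (of_real \<xi>) /
         of_real (sqrt (\<Sum>r<N. (cmod (u r (of_real \<xi>)))\<^sup>2)) * ez (- of_int n * of_real \<xi>))"
    proof (subst integral_mult_right [symmetric], rule integral_spike[OF bads, symmetric])
      fix \<xi> assume "\<xi> \<in> {0..1} - bads"
      then show "\<Psi> x \<xi> * ez (- of_real (x * \<xi>)) * ez (- of_int n * of_real \<xi>) =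
        of_real (1 / sqrt \<beta>) * (u 0 (of_real \<xi>) /
         of_real (sqrt (\<Sum>r<N. (cmod (u r (of_real \<xi>)))\<^sup>2)) * ez (- of_int n * of_real \<xi>))"
        using good[of \<xi> 0] energy[of \<xi>] N_pos by (simp add: \<Psi>_def)
    qed
    ultimately show "norm (integral {0..1} (\<lambda>\<xi>. \<Psi> x \<xi> * ez (- of_real (x * \<xi>)) * ez (- of_int n * of_real \<xi>)))
         \<le> B / sqrt \<beta> * exp (- b * \<bar>of_int n\<bar>)"
      using beta(1) by (simp add: norm_mult norm_divide divide_right_mono)
  qed
qed

text \<open>The partial sums are combinations of products of a function of \<open>w\<close> and one
  of \<open>x\<close>. The first factor is only Lebesgue measurable, the second is continuous,
  whence the mixed product space.\<close>

lemma G_measurable: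
  "(\<lambda>(w, x). G x (\<beta> * w + s)) \<in> borel_measurable (lebesgue \<Otimes>\<^sub>M lborel)"
proof -
  let ?t = "\<lambda>k (p :: real \<times> real). zc (\<beta> * fst p + s) k * ez (of_int k * of_real (snd p))"
  have lim: "(\<lambda>n. \<Sum>k\<in>{- int n..int n}. ?t k p) \<longlonglongrightarrow> G (snd p) (\<beta> * fst p + s)" for p
    unfolding G_eq_trig_series trig_series_def
    by (rule infsum_int_LIMSEQ[OF abs_summable_summable[OF
          trig_series_summable[OF norm_zc_le[OF order_refl] l_inverse_beta_pos]]])
      (use l_inverse_beta_pos in simp)
  have "?t k \<in> borel_measurable (lebesgue \<Otimes>\<^sub>M lborel)" for k
  proof -
    have "(\<lambda>w. g (1 * w + inverse \<beta> * (s - of_int k))) \<in> borel_measurable lebesgue"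
      by (intro lebesgue_measurable_affine g_meas) simp
    moreover have "1 * w + inverse \<beta> * (s - of_int k) = inverse \<beta> * (\<beta> * w + s - of_int k)" for w
      using beta(1) by (simp add: field_simps)
    ultimately have "(\<lambda>w. g (inverse \<beta> * (\<beta> * w + s - of_int k))) \<in> borel_measurable lebesgue"
      by simp
    then have 1: "(\<lambda>p. g (inverse \<beta> * (\<beta> * fst p + s - of_int k))) \<in> borel_measurable (lebesgue \<Otimes>\<^sub>M lborel)"
      by (rule measurable_compose[OF measurable_fst])
    have 1: "(\<lambda>p. of_real (g (inverse \<beta> * (\<beta> * fst p + s - of_int k))) :: complex) \<in> borel_measurable (lebesgue \<Otimes>\<^sub>M lborel)"
      by (rule measurable_compose[OF 1 borel_measurable_of_real])
    have "(\<lambda>x::real. ez (of_int k * of_real x)) \<in> borel_measurable lborel"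
      by (simp add: borel_measurable_continuous_onI continuous_on_ez continuous_on_of_real
          continuous_on_mult_left continuous_on_id)
    then have 2: "(\<lambda>p. ez (of_int k * of_real (snd p))) \<in> borel_measurable (lebesgue \<Otimes>\<^sub>M lborel)"
      by (rule measurable_compose[OF measurable_snd])
    show ?thesis
      unfolding zc_def using 1 2
      by (intro borel_measurable_times borel_measurable_const)
  qed
  then have "(\<lambda>p. G (snd p) (\<beta> * fst p + s)) \<in> borel_measurable (lebesgue \<Otimes>\<^sub>M lborel)"
    by (intro borel_measurable_LIMSEQ_metric[OF _ lim] borel_measurable_sum)
  then show ?thesis
    by (simp add: case_prod_beta')
qed

lemma \<phi>hat_measurable: "\<phi>hat \<in> borel_measurable lebesgue"
proof -
  let ?M = "lebesgue \<Otimes>\<^sub>M (lborel :: real measure)"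
  have G: "(\<lambda>p. G (snd p) (\<beta> * fst p + s)) \<in> borel_measurable ?M" for s
    using G_measurable[of s] by (simp add: case_prod_beta')
  have "(\<lambda>p. energy (snd p) (\<beta> * fst p)) \<in> borel_measurable ?M"
    unfolding energy_def
  proof (intro borel_measurable_sum borel_measurable_power)
    show "(\<lambda>p. cmod (G (snd p) (\<beta> * fst p - \<beta> * real r))) \<in> borel_measurable ?M" for r
      using measurable_compose[OF G[of "- \<beta> * real r"] borel_measurable_norm] by simp
  qed
  then have "(\<lambda>p. of_real (sqrt (energy (snd p) (\<beta> * fst p))) :: complex) \<in> borel_measurable ?M"
    by (intro measurable_compose[OF _ borel_measurable_of_real] measurable_compose[OF _ borel_measurable_sqrt])
  moreover have "(\<lambda>p. G (snd p) (\<beta> * fst p)) \<in> borel_measurable ?M"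
    using G[of 0] by simp
  ultimately have "(\<lambda>p. \<Psi> (snd p) (\<beta> * fst p)) \<in> borel_measurable ?M"
    unfolding \<Psi>_def by (intro borel_measurable_times borel_measurable_const borel_measurable_divide)
  moreover have "(\<lambda>p. indicator {0..1} (snd p) :: real) \<in> borel_measurable ?M"
    by (rule measurable_compose[OF measurable_snd]) simp
  ultimately have "(\<lambda>p. indicator {0..1} (snd p) *\<^sub>R \<Psi> (snd p) (\<beta> * fst p)) \<in> borel_measurable ?M"
    by (intro borel_measurable_scaleR)
  then have "(\<lambda>w. LINT x|lborel. indicator {0..1} x *\<^sub>R \<Psi> x (\<beta> * w)) \<in> borel_measurable lebesgue"
    by (intro lborel.borel_measurable_lebesgue_integral) (simp add: case_prod_beta')
  moreover have "(LINT x|lborel. indicator {0..1} x *\<^sub>R \<Psi> x (\<beta> * w)) = (LINT x:{0..1}|lebesgue. \<Psi> x (\<beta> * w))" for w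
  proof -
    have "(\<lambda>x. \<Psi> x (\<beta> * w)) \<in> borel_measurable borel"
      by (intro borel_measurable_continuous_onI \<Psi>_continuous)
    then have "(\<lambda>x. indicator {0..1} x *\<^sub>R \<Psi> x (\<beta> * w)) \<in> borel_measurable lborel"
      by (intro borel_measurable_scaleR) auto
    then show ?thesis
      unfolding set_lebesgue_integral_def by (rule integral_completion [symmetric])
  qed
  ultimately have "(\<lambda>w. LINT x:{0..1}|lebesgue. \<Psi> x (\<beta> * w)) \<in> borel_measurable lebesgue"
    by simp
  then show ?thesis
    unfolding \<phi>hat_def inv_zak_def[abs_def] by (intro borel_measurable_times borel_measurable_const)
qed

text \<open>Folding the integral with step \<open>1 / \<beta>\<close> turns the integrand into the
  Zak transform of \<open>\<phi>hat\<close> at \<open>X\<close>, times a twist. The sign of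
  \<open>X\<close> makes the phase in \<open>k\<close> agree with that of
  \<open>zak\<close>.\<close>

lemma inv_fourier_\<phi>hat:
  fixes t :: real
  defines "X \<equiv> - inverse \<beta> * t"
  shows "inv_fourier \<phi>hat t =
    of_real (1 / sqrt \<beta>) * integral {0..1} (\<lambda>\<xi>. \<Psi> X \<xi> * ez (- of_real (X * \<xi>)))"
proof -
  obtain B b where B: "B > 0" "b > 0" and le: "\<And>w. norm (\<phi>hat w) \<le> B * exp (- b * \<bar>w\<bar>)"
    by (rule \<phi>hat_decay) blast
  define F where "F w = \<phi>hat w * ez (of_real (t * w))" for w
  have "(\<lambda>w::real. ez (of_real (t * w))) \<in> borel_measurable lebesgue"
    using continuous_imp_measurable_on_sets_lebesgue[of UNIV "\<lambda>w::real. ez (of_real (t * w))"]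
    by (simp add: lebesgue_on_UNIV_eq continuous_on_ez continuous_on_of_real
        continuous_on_mult_left continuous_on_id)
  then have F: "F \<in> borel_measurable lebesgue"
    unfolding F_def[abs_def] by (intro borel_measurable_times \<phi>hat_measurable)
  have F_le: "norm (F w) \<le> B * exp (- b * \<bar>w\<bar>)" for w
    using le[of w] by (simp add: F_def norm_mult)
  have "inv_fourier \<phi>hat t = integral\<^sup>L lebesgue F"
    unfolding inv_fourier_def F_def[abs_def] ez_def by (simp add: mult_ac)
  also have "\<dots> = integral UNIV F"
    by (rule lebesgue_integral_exp_bounded(3)[OF F F_le B(2)])
  also have "\<dots> = of_real (inverse \<beta>) *
      integral {0..1} (\<lambda>\<xi>. \<Sum>\<^sub>\<infinity>k. F (inverse \<beta> * (\<xi> - of_int k)))"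
    by (rule integral_eq_integral_periodization[OF F F_le B(2) inverse_beta_pos])
  also have "(\<lambda>\<xi>. \<Sum>\<^sub>\<infinity>k. F (inverse \<beta> * (\<xi> - of_int k))) =
      (\<lambda>\<xi>. of_real (sqrt \<beta>) * (\<Psi> X \<xi> * ez (- of_real (X * \<xi>))))"
  proof
    fix \<xi> :: real
    have "F (inverse \<beta> * (\<xi> - of_int k)) =
        \<phi>hat (inverse \<beta> * (\<xi> - of_int k)) * ez (of_int k * of_real X) * ez (- of_real (X * \<xi>))" for k
    proof -
      have "ez (of_real (t * (inverse \<beta> * (\<xi> - of_int k)))) = ez (of_int k * of_real X + - of_real (X * \<xi>))"
        by (rule arg_cong[of _ _ ez]) (simp add: X_def algebra_simps)
      then show ?thesis by (simp only: F_def ez_add mult.assoc)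
    qed
    then have "(\<Sum>\<^sub>\<infinity>k. F (inverse \<beta> * (\<xi> - of_int k))) =
        (\<Sum>\<^sub>\<infinity>k. \<phi>hat (inverse \<beta> * (\<xi> - of_int k)) * ez (of_int k * of_real X)) * ez (- of_real (X * \<xi>))"
      by (simp only: infsum_cmult_left')
    moreover have "zak \<beta> \<phi>hat X \<xi> = of_real (1 / sqrt \<beta>) *
        (\<Sum>\<^sub>\<infinity>k. \<phi>hat (inverse \<beta> * (\<xi> - of_int k)) * ez (of_int k * of_real X))"
      by (simp add: zak_def ez_def mult.assoc)
    ultimately show "(\<Sum>\<^sub>\<infinity>k. F (inverse \<beta> * (\<xi> - of_int k))) =
        of_real (sqrt \<beta>) * (\<Psi> X \<xi> * ez (- of_real (X * \<xi>)))"
      using beta(1) by (simp add: zak_\<phi>hat field_simps)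
  qed
  also have "of_real (inverse \<beta>) * integral {0..1} (\<lambda>\<xi>. of_real (sqrt \<beta>) * (\<Psi> X \<xi> * ez (- of_real (X * \<xi>)))) =
      of_real (inverse \<beta> * sqrt \<beta>) * integral {0..1} (\<lambda>\<xi>. \<Psi> X \<xi> * ez (- of_real (X * \<xi>)))"
    by (simp only: integral_mult_right of_real_mult mult.assoc)
  also have "inverse \<beta> * sqrt \<beta> = 1 / sqrt \<beta>"
    using beta(1) by (simp add: field_simps)
  finally show ?thesis .
qed

text \<open>Splitting \<open>X\<close> into fractional part \<open>x\<close> and integer part
  \<open>n\<close> leaves \<open>\<Psi>\<close> at \<open>x\<close> by periodicity, while the twist
  contributes the character of index \<open>n\<close>. The value is thus a dual coefficient, and
  \<open>\<bar>n\<bar>\<close> differs from \<open>\<bar>t\<bar> / \<beta>\<close> by at most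
  1.\<close>

lemma \<phi>_decay: "exponential_decay (inv_fourier \<phi>hat)"
proof -
  obtain B b where B: "B > 0" "b > 0"
    and le: "\<And>x n. x \<in> {0..1} \<Longrightarrow>
       norm (integral {0..1} (\<lambda>\<xi>. \<Psi> x \<xi> * ez (- of_real (x * \<xi>)) * ez (- of_int n * of_real \<xi>)))
         \<le> B * exp (- b * \<bar>of_int n\<bar>)"
    by (rule dual_coeff_decay) blast
  have "norm (inv_fourier \<phi>hat t) \<le> (B / sqrt \<beta> * exp b) * exp (- (b * inverse \<beta>) * \<bar>t\<bar>)" for t
  proof -
    define X where "X = - inverse \<beta> * t"
    define x where "x = frac X"
    define n where "n = \<lfloor>X\<rfloor>"
    have x: "x \<in> {0..1}" and X: "X = x + of_int n"
      using real_frac_decomp(2)[of X] by (auto simp: x_def n_def frac_def)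
    have "\<Psi> X \<xi> * ez (- of_real (X * \<xi>)) =
        \<Psi> x \<xi> * ez (- of_real (x * \<xi>)) * ez (- of_int n * of_real \<xi>)" for \<xi>
    proof -
      have "- of_real (X * \<xi>) = - of_real (x * \<xi>) + - of_int n * (of_real \<xi> :: complex)"
        by (simp add: X algebra_simps)
      then show ?thesis
        by (simp only: X \<Psi>_add_int ez_add mult.assoc)
    qed
    then have "inv_fourier \<phi>hat t = of_real (1 / sqrt \<beta>) *
       integral {0..1} (\<lambda>\<xi>. \<Psi> x \<xi> * ez (- of_real (x * \<xi>)) * ez (- of_int n * of_real \<xi>))"
      using inv_fourier_\<phi>hat[of t] by (simp only: X_def [symmetric])
    then have "norm (inv_fourier \<phi>hat t) \<le> 1 / sqrt \<beta> * (B * exp (- b * \<bar>of_int n\<bar>))"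
      using le[OF x, of n] beta(1) by (simp add: norm_mult norm_divide divide_right_mono)
    also have "\<dots> \<le> 1 / sqrt \<beta> * (B * (exp b * exp (- (b * inverse \<beta>) * \<bar>t\<bar>)))"
    proof -
      have "\<bar>inverse \<beta> * t\<bar> \<le> 1 + \<bar>of_int n\<bar>"
        using X x by (auto simp: X_def)
      then have "b * \<bar>inverse \<beta> * t\<bar> \<le> b * (1 + \<bar>of_int n\<bar>)"
        using B by (intro mult_left_mono) auto
      then have "exp (- b * \<bar>of_int n\<bar>) \<le> exp b * exp (- (b * inverse \<beta>) * \<bar>t\<bar>)"
        using beta(1) by (simp add: abs_mult distrib_left mult.assoc flip: exp_add)
      then show ?thesis
        using B beta by (intro mult_left_mono) auto
    qed
    finally show ?thesis by (simp add: mult.assoc)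
  qed
  moreover have "B / sqrt \<beta> * exp b > 0" "b * inverse \<beta> > 0"
    using B beta(1) by auto
  ultimately show ?thesis
    unfolding exponential_decay_def by blast
qed

end

text \<open>Measurability of \<open>g\<close> makes its Fourier integral meaningful. Integrability
  of \<open>\<phi>hat\<close> stands in the conclusion so that \<open>\<phi>\<close> is a genuine
  inverse transform and not the default value 0 of an undefined integral.\<close>

theorem theorem4p4:
  fixes \<beta> C l m :: real and N :: nat and g :: "real \<Rightarrow> real"
    and G \<Psi> :: "real \<Rightarrow> real \<Rightarrow> complex" and \<phi>hat \<phi> :: "real \<Rightarrow> complex"
  assumes beta: "\<beta> > 0" "inverse \<beta> = real N"
    and pos: "C > 0" "l > 0" "m > 0"
    and g_meas: "g \<in> borel_measurable lebesgue"
    and g_decay: "\<And>x. \<bar>g x\<bar> \<le> C * exp (- l * \<bar>x\<bar>)"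
    and ghat_decay: "\<And>\<xi>. cmod (fourier (\<lambda>x. of_real (g x)) \<xi>) \<le> C * exp (- m * \<bar>\<xi>\<bar>)"
    and G: "G = zak \<beta> (\<lambda>x. of_real (g x))"
    and inf_pos: "(INF (x, \<xi>)\<in>{0..1} \<times> {0..1}. \<Sum>r<N. (cmod (G x (\<xi> - \<beta> * real r)))\<^sup>2) > 0"
    and Psi: "\<And>x \<xi>. \<Psi> x \<xi> = of_real (1 / sqrt \<beta>) *
                (G x \<xi> / of_real (sqrt (\<Sum>r<N. (cmod (G x (\<xi> - \<beta> * real r)))\<^sup>2)))"
    and phihat: "\<phi>hat = inv_zak \<beta> \<Psi>"
    and phi: "\<phi> = inv_fourier \<phi>hat"
  shows "(\<forall>\<xi>. \<phi>hat \<xi> \<in> \<real>) \<and>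
    (AE (x, \<xi>) in lebesgue_on ({0..1} \<times> {0..1}).
       (\<Sum>r<N. (cmod (zak \<beta> \<phi>hat x (\<xi> - \<beta> * real r)))\<^sup>2) = 1 / \<beta>) \<and>
    integrable lebesgue \<phi>hat \<and>
    exponential_decay \<phi> \<and> exponential_decay \<phi>hat"
proof -
  let ?S = "\<lambda>(x, \<xi>). \<Sum>r<N. (cmod (G x (\<xi> - \<beta> * real r)))\<^sup>2"
  define \<delta> where "\<delta> = (INF p\<in>{0..1} \<times> {0..1}. ?S p)"
  have low: "\<delta> \<le> (\<Sum>r<N. (cmod (G x (\<xi> - \<beta> * real r)))\<^sup>2)" if "x \<in> {0..1}" "\<xi> \<in> {0..1}" for x \<xi>
  proof -
    \<comment> \<open>An infimum of reals is a lower bound only for sets bounded below; sums of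
      squares are bounded below by 0.\<close>
    have "bdd_below (?S ` ({0..1} \<times> {0..1}))"
      by (rule bdd_belowI[of _ 0]) (auto intro!: sum_nonneg)
    from cINF_lower[OF this, of "(x, \<xi>)"] that show ?thesis
      by (simp add: \<delta>_def)
  qed
  have "\<delta> > 0" using inf_pos by (simp add: \<delta>_def)
  interpret W: zak_window \<beta> C l m \<delta> N g
    using beta pos \<open>\<delta> > 0\<close> g_meas g_decay ghat_decay low by unfold_locales (simp_all add: G)
  have "\<Psi> = W.\<Psi>"
    by (intro ext) (simp add: Psi W.\<Psi>_def W.energy_def W.G_def G)
  then have \<phi>hat: "\<phi>hat = W.\<phi>hat"
    by (simp add: phihat W.\<phi>hat_def)
  obtain B b where B: "B > 0" "b > 0" and le: "\<And>w. norm (\<phi>hat w) \<le> B * exp (- b * \<bar>w\<bar>)"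
    unfolding \<phi>hat by (rule W.\<phi>hat_decay) blast
  have "integrable lebesgue \<phi>hat"
    using lebesgue_integral_exp_bounded(1)[OF _ le B(2)] W.\<phi>hat_measurable \<phi>hat by simp
  moreover have "exponential_decay \<phi>hat"
    unfolding exponential_decay_def using B le by blast
  \<comment> \<open>The identity holds at every point, which implies the almost everywhere
    statement.\<close>
  moreover have "(\<Sum>r<N. (cmod (zak \<beta> \<phi>hat x (\<xi> - \<beta> * real r)))\<^sup>2) = 1 / \<beta>" for x \<xi>
    by (simp only: \<phi>hat W.zak_\<phi>hat W.sum_norm_\<Psi>)
  ultimately show ?thesis
    using W.\<phi>hat_real W.\<phi>_decay by (simp add: \<phi>hat phi)
qed

end
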